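(* Let $n\ge2$, $\alpha\ge0$, and consider on $\mathbb P^n$ a completely integrable system in canonical form $$\frac{\partial^2u}{\partial z_i\partial z_j}=\sum_{k=1}^nP^k_{ij}(z)\frac{\partial u}{\partial z_k}+P^0_{ij}(z)u,\qquad i,j=1,\dots,n,$$ with $\|P\|\le\alpha$. Let $u$ be the solution with $u(0)=1$, $\nabla u(0)=0$. If $$n\sqrt n\,\alpha\le\frac1{6.1},$$ then $u$ does not vanish in $\mathbb P^n$ and $$\left|\frac{\nabla u}{u}(z)\right|\le\frac{|z|_\infty}{1-|z|_\infty^2},\qquad z\in\mathbb P^n.$$
   Context: $\mathbb P^n=\{z\in\mathbb C^n:|z_i|<1,\ i=1,\dots,n\}$; $|\cdot|$ is the Euclidean norm and $|z|_\infty=\max_i|z_i|$. The coefficients $P^k_{ij}$ ($i,j=1,\dots,n$; $k=0,\dots,n$) are holomorphic in $\mathbb P^n$. The system is completely integrable if it has $n+1$ (the maximum number of) linearly independent solutions, and is in canonical form if $\sum_{j=1}^nP^j_{ij}=0$ for $i=1,\dots,n$. The Bergman norm of $\vec v\in T_z\mathbb P^n$ is $\|\vec v\|=\big[2\sum_i|v_i|^2/(1-|z_i|^2)^2\big]^{1/2}$. With $P(z)(\vec v)=\big(\sum_{i,j}P^k_{ij}(z)v_iv_j\big)_{k=1,\dots,n}$, set $\|P\|=\sup_{z\in\mathbb P^n}\sup_{\|\vec v\|=1}\|P(z)(\vec v)\|$ (Bergman norms at $z$). Equivalently $\|P\|$ is the norm $\|S_f\|$ of the Schwarzian operator of any mapping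 $f$ whose Schwarzian derivatives $S^k_{ij}f$ are the $P^k_{ij}$, $1\le i,j,k\le n$. *)

theory Defs
  imports "HOL-Analysis.Analysis"
begin

definition polydisc :: "(complex ^ 'n) set" where
  "polydisc = {z. \<forall>i. norm (z $ i) < 1}"

text \<open>The library's \<open>infnorm\<close> is taken over real coordinates, so it is not the
  maximum of the moduli of the complex coordinates.\<close>
definition max_norm :: "complex ^ 'n \<Rightarrow> real" where
  "max_norm z = Max (range (\<lambda>i. norm (z $ i)))"

text \<open>Holomorphy in several variables: complex differentiability, i.e. the Frechet
  derivative exists (as a real-linear map) and is complex-linear. Intended for open \<open>S\<close>.\<close>
definition holomorphic_cn :: "(complex ^ 'n \<Rightarrow> complex) \<Rightarrow> (complex ^ 'n) set \<Rightarrow> bool" where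
  "holomorphic_cn f S \<longleftrightarrow>
     (\<forall>z\<in>S. \<exists>D. (f has_derivative D) (at z) \<and> (\<forall>c v. D (c *s v) = c * D v))"

definition cpartial :: "'n \<Rightarrow> (complex ^ 'n \<Rightarrow> complex) \<Rightarrow> complex ^ 'n \<Rightarrow> complex" where
  "cpartial i f z = deriv (\<lambda>t. f (z + t *s axis i 1)) 0"

definition cgrad :: "(complex ^ 'n \<Rightarrow> complex) \<Rightarrow> complex ^ 'n \<Rightarrow> complex ^ 'n" where
  "cgrad f z = (\<chi> i. cpartial i f z)"

text \<open>Throughout, \<open>P i j k\<close> stands for \<open>P\<^sup>k\<^sub>i\<^sub>j\<close> with \<open>k = 1, \<dots>, n\<close>, and the coefficient
  \<open>P\<^sup>0\<^sub>i\<^sub>j\<close> is the separate family \<open>P0 i j\<close>.\<close>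

definition is_solution ::
  "('n \<Rightarrow> 'n \<Rightarrow> 'n \<Rightarrow> complex ^ 'n \<Rightarrow> complex) \<Rightarrow> ('n \<Rightarrow> 'n \<Rightarrow> complex ^ 'n \<Rightarrow> complex)
    \<Rightarrow> (complex ^ 'n \<Rightarrow> complex) \<Rightarrow> bool" where
  "is_solution P P0 u \<longleftrightarrow>
     holomorphic_cn u polydisc \<and>
     (\<forall>z\<in>polydisc. \<forall>i j.
        cpartial i (cpartial j u) z
          = (\<Sum>k\<in>UNIV. P i j k z * cpartial k u z) + P0 i j z * u z)"

text \<open>There are \<open>n + 1\<close> solutions \<open>U 0, \<dots>, U n\<close> that are linearly independent over the
  complex numbers as functions on the polydisc.\<close>
definition completely_integrable ::
  "('n \<Rightarrow> 'n \<Rightarrow> 'n \<Rightarrow> complex ^ 'n \<Rightarrow> complex) \<Rightarrow> ('n \<Rightarrow> 'n \<Rightarrow> complex ^ 'n \<Rightarrow> complex) \<Rightarrow> bool" where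
  "completely_integrable P P0 \<longleftrightarrow>
     (\<exists>U :: nat \<Rightarrow> complex ^ 'n \<Rightarrow> complex.
        (\<forall>m \<le> CARD('n). is_solution P P0 (U m)) \<and>
        (\<forall>c :: nat \<Rightarrow> complex.
           (\<forall>z\<in>polydisc. (\<Sum>m\<le>CARD('n). c m * U m z) = 0) \<longrightarrow> (\<forall>m \<le> CARD('n). c m = 0)))"

definition canonical_form :: "('n \<Rightarrow> 'n \<Rightarrow> 'n \<Rightarrow> complex ^ 'n \<Rightarrow> complex) \<Rightarrow> bool" where
  "canonical_form P \<longleftrightarrow> (\<forall>z\<in>polydisc. \<forall>i. (\<Sum>j\<in>UNIV. P i j j z) = 0)"

definition bergman_norm :: "complex ^ 'n \<Rightarrow> complex ^ 'n \<Rightarrow> real" where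
  "bergman_norm z v = sqrt (2 * (\<Sum>i\<in>UNIV. (norm (v $ i))\<^sup>2 / (1 - (norm (z $ i))\<^sup>2)\<^sup>2))"

definition quad_op ::
  "('n \<Rightarrow> 'n \<Rightarrow> 'n \<Rightarrow> complex ^ 'n \<Rightarrow> complex) \<Rightarrow> complex ^ 'n \<Rightarrow> complex ^ 'n \<Rightarrow> complex ^ 'n" where
  "quad_op P z v = (\<chi> k. \<Sum>i\<in>UNIV. \<Sum>j\<in>UNIV. P i j k z * v $ i * v $ j)"

text \<open>Extended-real valued, as the supremum over the polydisc may be infinite.\<close>
definition op_norm ::
  "('n \<Rightarrow> 'n \<Rightarrow> 'n \<Rightarrow> complex ^ 'n \<Rightarrow> complex) \<Rightarrow> ereal" where
  "op_norm P =
     (SUP z\<in>polydisc. SUP v\<in>{v. bergman_norm z v = 1}. ereal (bergman_norm z (quad_op P z v)))"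

end

theory Submission
  imports Defs "HOL-Complex_Analysis.Conformal_Mappings"
begin

text \<open>Restrict the solution to a ray \<open>t \<mapsto> t \<zeta>\<close> with \<open>|\<zeta>|\<^sub>\<infinity> = 1\<close>. With \<open>U = u(t \<zeta>)\<close>,
  \<open>W = \<nabla>u(t \<zeta>)\<close> and \<open>\<delta> = 1 - t\<^sup>2\<close> the system becomes a linear ODE with
  \<open>|U'| \<le> \<surd>n |W|\<close> and \<open>|W'| \<le> (a / \<delta>) |W| + (b / \<delta>\<^sup>2) |U|\<close>, and \<open>|W| \<le> t |U| / (\<surd>n \<delta>)\<close> is
  preserved as soon as \<open>a + \<surd>n b < 1\<close>; this is stronger than the claim.

  To find \<open>a\<close>, note that on the torus \<open>|z\<^sub>i| = r\<close> the Bergman norm is \<open>\<surd>2 / (1 - r\<^sup>2)\<close> times the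
  Euclidean norm. Polarization and the maximum principle therefore give
  \<open>|P(x, y)| \<le> \<beta> |x| |y| / (1 - r\<^sup>2)\<close> on \<open>|z|\<^sub>\<infinity> \<le> r\<close> with \<open>\<beta> = \<surd>2 \<alpha>\<close>, so \<open>a = \<beta> \<surd>n\<close>.

  To find \<open>b\<close>, compare the mixed third derivatives of the solutions. Complete integrability makes
  the resulting relation an identity between coefficients, which expresses \<open>P\<^sup>0\<close> by \<open>P\<close> and first
  derivatives of \<open>P\<close>; the latter are bounded by Cauchy and Schwarz estimates. A contraction adapted
  to \<open>\<zeta>\<close> yields \<open>b = 2 \<beta>\<^sup>2 \<surd>n + 10 \<beta> / 3 + 4 \<beta> \<surd>(n - 1)\<close>. The condition \<open>a + \<surd>n b < 1\<close> is
  tightest for \<open>n = 2\<close>, where the left-hand side is about \<open>0.993\<close>.\<close>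

subsection \<open>Complex coordinate space\<close>

lemma norm_vec_smult: "norm (c *s v) = norm c * norm (v :: complex ^ 'n::finite)"
  by (simp add: norm_vec_def L2_set_right_distrib norm_mult)

lemma norm_axis_complex [simp]: "norm (axis i c :: complex ^ 'n::finite) = norm c"
proof -
  have "(\<Sum>j\<in>UNIV. (norm ((axis i c :: complex ^ 'n) $ j))\<^sup>2) = (norm c)\<^sup>2"
    by (simp add: axis_def if_distrib[where f=norm] if_distrib[where f="\<lambda>x. x\<^sup>2"] cong: if_cong)
  then show ?thesis by (simp add: norm_vec_def L2_set_def)
qed

lemma sum_axis_mult [simp]: "(\<Sum>j\<in>UNIV. (axis i (1::complex) :: complex ^ 'n::finite) $ j * F j) = F i"
  by (simp add: axis_def if_distrib[where f="\<lambda>x. x * _"] cong: if_cong)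

lemma norm_line_le: "norm (x + t *s v - z) \<le> norm (x - z) + norm t * norm (v :: complex ^ 'n::finite)"
proof -
  have eq: "x + t *s v - z = (x - z) + t *s v" by simp
  show ?thesis unfolding eq norm_vec_smult[symmetric] by (rule norm_triangle_ineq)
qed

lemma vec_expand_axis: "v = (\<Sum>i\<in>UNIV. v $ i *s axis i (1::complex))"
  by (simp add: vec_eq_iff axis_def if_distrib cong: if_cong)

lemma norm_bilinear_le:
  fixes x y :: "complex ^ 'n::finite"
  shows "norm (\<Sum>i\<in>UNIV. x $ i * y $ i) \<le> norm x * norm y"
proof -
  have "norm (\<Sum>i\<in>UNIV. x $ i * y $ i) \<le> (\<Sum>i\<in>UNIV. \<bar>norm (x $ i)\<bar> * \<bar>norm (y $ i)\<bar>)"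
    by (rule order_trans[OF norm_sum]) (simp add: norm_mult)
  also have "\<dots> \<le> norm x * norm y"
    unfolding norm_vec_def by (rule L2_set_mult_ineq)
  finally show ?thesis .
qed

text \<open>The pairing carries no conjugation, so it is tested on the conjugate of
  \<open>y\<close>, where it equals the squared norm. This turns bounds for scalar contractions back
  into bounds for vectors.\<close>

lemma norm_le_of_bilinear:
  fixes y :: "complex ^ 'n::finite"
  assumes "\<And>v. norm (\<Sum>i\<in>UNIV. v $ i * y $ i) \<le> C * norm v"
  shows "norm y \<le> C"
proof (cases "y = 0")
  case True
  have "0 \<le> C"
    using order_trans[OF norm_ge_zero assms[of "axis undefined 1"]] by simp
  then show ?thesis using True by simp
next
  case False
  let ?v = "\<chi> i. cnj (y $ i)"
  have nv: "norm ?v = norm y"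
    by (simp add: norm_vec_def)
  have "(\<Sum>i\<in>UNIV. ?v $ i * y $ i) = complex_of_real (\<Sum>i\<in>UNIV. (norm (y $ i))\<^sup>2)"
    unfolding of_real_sum complex_norm_square by (simp add: mult.commute)
  also have "(\<Sum>i\<in>UNIV. (norm (y $ i))\<^sup>2) = (norm y)\<^sup>2"
    by (simp add: norm_vec_def L2_set_def sum_nonneg)
  finally have "(norm y)\<^sup>2 \<le> C * norm y"
    using assms[of ?v] nv by (simp add: norm_power)
  then show ?thesis using False by (simp add: power2_eq_square)
qed

lemma has_derivative_vec_lambda:
  fixes f :: "'n::finite \<Rightarrow> 'a::real_normed_vector \<Rightarrow> complex"
  assumes "\<And>i. (f i has_derivative f' i) F"
  shows "((\<lambda>x. \<chi> i. f i x) has_derivative (\<lambda>h. \<chi> i. f' i h)) F"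
proof -
  have bl: "bounded_linear (axis i :: complex \<Rightarrow> complex ^ 'n)" for i
    by (rule bounded_linear_intro[where K=1]) (simp_all add: vec_eq_iff, simp_all add: axis_def)
  have expand: "(\<chi> i. g i) = (\<Sum>i\<in>UNIV. axis i (g i :: complex))" for g :: "'n \<Rightarrow> complex"
    by (simp add: vec_eq_iff axis_def if_distrib cong: if_cong)
  show ?thesis
    unfolding expand by (intro has_derivative_sum bounded_linear.has_derivative[OF bl] assms)
qed

lemma has_vector_derivative_vec_lambda:
  fixes f :: "'n::finite \<Rightarrow> real \<Rightarrow> complex"
  assumes "\<And>i. (f i has_vector_derivative f' i) F"
  shows "((\<lambda>x. \<chi> i. f i x) has_vector_derivative (\<chi> i. f' i)) F"
proof -
  have "((\<lambda>x. \<chi> i. f i x) has_derivative (\<lambda>h. \<chi> i. h *\<^sub>R f' i)) F"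
    using assms unfolding has_vector_derivative_def by (rule has_derivative_vec_lambda)
  moreover have "(\<lambda>h. \<chi> i. h *\<^sub>R f' i) = (\<lambda>h. h *\<^sub>R (\<chi> i. f' i))"
    by (simp add: vec_eq_iff fun_eq_iff)
  ultimately show ?thesis unfolding has_vector_derivative_def by simp
qed

lemma open_polydisc: "open (polydisc :: (complex ^ 'n::finite) set)"
proof -
  have "polydisc = (\<Inter>i\<in>UNIV. {z :: complex ^ 'n. norm (z $ i) < 1})"
    by (auto simp: polydisc_def)
  also have "open \<dots>"
    by (intro open_INT ballI open_Collect_less continuous_intros) simp
  finally show ?thesis .
qed

subsection \<open>Separately holomorphic functions\<close>

text \<open>This class is closed under partial derivatives, which for \<^const>\<open>holomorphic_cn\<close> would
  need the full Osgood lemma.\<close>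
definition slice_holomorphic :: "(complex ^ 'n::finite \<Rightarrow> complex) \<Rightarrow> (complex ^ 'n) set \<Rightarrow> bool" where
  "slice_holomorphic f S \<longleftrightarrow> continuous_on S f \<and>
     (\<forall>z\<in>S. \<forall>v. ((\<lambda>t. f (z + t *s v)) has_field_derivative (\<Sum>j\<in>UNIV. v $ j * cpartial j f z)) (at 0))"

lemma slice_holomorphic_line:
  assumes "slice_holomorphic f S" "z + t *s v \<in> S"
  shows "((\<lambda>t. f (z + t *s v)) has_field_derivative (\<Sum>j\<in>UNIV. v $ j * cpartial j f (z + t *s v))) (at t)"
proof -
  have "((\<lambda>s. f ((z + t *s v) + s *s v)) has_field_derivative
      (\<Sum>j\<in>UNIV. v $ j * cpartial j f (z + t *s v))) (at 0)"
    using assms unfolding slice_holomorphic_def by blast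
  moreover have "(\<lambda>s. f ((z + t *s v) + s *s v)) = (\<lambda>s. f (z + (s + t) *s v))"
    by (simp add: vec.scale_left_distrib algebra_simps)
  ultimately show ?thesis
    using DERIV_shift[of "\<lambda>t. f (z + t *s v)" _ 0 t] by simp
qed

lemma slice_holomorphic_axis:
  assumes "slice_holomorphic f S" "z \<in> S"
  shows "((\<lambda>t. f (z + t *s axis i 1)) has_field_derivative cpartial i f z) (at 0)"
proof -
  have "((\<lambda>t. f (z + t *s axis i 1)) has_field_derivative
      (\<Sum>j\<in>UNIV. axis i 1 $ j * cpartial j f z)) (at 0)"
    using assms unfolding slice_holomorphic_def by blast
  then show ?thesis by simp
qed

lemma cpartial_eqI:
  "((\<lambda>t. f (z + t *s axis i 1)) has_field_derivative d) (at 0) \<Longrightarrow> cpartial i f z = d"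
  by (simp add: cpartial_def DERIV_imp_deriv)

lemma smult_line_has_derivative:
  "((\<lambda>t::complex. z + t *s v) has_derivative (\<lambda>h. h *s (v :: complex ^ 'n::finite))) (at t)"
proof -
  have "bounded_linear (\<lambda>h::complex. h *s v)"
    by (intro bounded_linear_intro[where K="norm v"])
      (auto simp: vec.scale_left_distrib norm_vec_smult vec_eq_iff)
  from bounded_linear_imp_has_derivative[OF this] show ?thesis
    by (auto intro!: derivative_eq_intros)
qed

lemma continuous_on_smult_line [continuous_intros]:
  "continuous_on A (\<lambda>t::complex. z + t *s (v :: complex ^ 'n::finite))"
  by (intro continuous_at_imp_continuous_on ballI has_derivative_continuous[OF smult_line_has_derivative])

lemma open_line_preimage:
  assumes "open S"
  shows "open {t::complex. z + t *s (v :: complex ^ 'n::finite) \<in> S}"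
  using open_vimage[OF assms continuous_on_smult_line[of UNIV z v]] by (simp add: vimage_def)

lemma holomorphic_cn_imp_slice_holomorphic:
  fixes f :: "complex ^ 'n::finite \<Rightarrow> complex"
  assumes "holomorphic_cn f S"
  shows "slice_holomorphic f S"
proof -
  have *: "((\<lambda>t. f (z + t *s v)) has_field_derivative (\<Sum>j\<in>UNIV. v $ j * cpartial j f z)) (at 0)"
    if z: "z \<in> S" for z v
  proof -
    obtain D where D: "(f has_derivative D) (at z)" and lin: "\<And>c v. D (c *s v) = c * D v"
      using assms z unfolding holomorphic_cn_def by blast
    have line: "((\<lambda>t. f (z + t *s v)) has_field_derivative D v) (at 0)" for v
    proof -
      have "(f \<circ> (\<lambda>t. z + t *s v) has_derivative D \<circ> (\<lambda>h. h *s v)) (at 0)"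
        by (rule diff_chain_at[OF smult_line_has_derivative]) (simp add: D)
      then show ?thesis
        by (simp add: has_field_derivative_def o_def lin mult.commute[of _ "D v"])
    qed
    have "D v = (\<Sum>j\<in>UNIV. D (v $ j *s axis j 1))"
      by (subst vec_expand_axis) (rule linear_sum[OF has_derivative_linear[OF D]])
    also have "\<dots> = (\<Sum>j\<in>UNIV. v $ j * cpartial j f z)"
      by (simp add: lin cpartial_eqI[OF line])
    finally show ?thesis using line[of v] by simp
  qed
  moreover have "continuous_on S f"
    using assms unfolding holomorphic_cn_def
    by (meson continuous_at_imp_continuous_on has_derivative_continuous)
  ultimately show ?thesis unfolding slice_holomorphic_def by blast
qed

text \<open>On a complex line in direction \<open>axis i 1\<close> this is Taylor's formula of first
  order with a Cauchy bound for the second derivative. Since \<open>C\<close> does not depend on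
  \<open>x\<close>, the difference quotients converge uniformly near \<open>z\<close>.\<close>

lemma difference_quotient_bound:
  fixes f :: "complex ^ 'n::finite \<Rightarrow> complex"
  assumes S: "open S" and f: "slice_holomorphic f S" and z: "z \<in> S"
  obtains r C where "r > 0" "C \<ge> 0" "ball z (2 * r) \<subseteq> S"
    "\<And>x h. x \<in> ball z r \<Longrightarrow> h \<noteq> 0 \<Longrightarrow> norm h < r \<Longrightarrow>
       norm ((f (x + h *s axis i 1) - f x) / h - cpartial i f x) \<le> C * norm h"
proof -
  obtain R where R: "R > 0" "cball z R \<subseteq> S"
    using S z open_contains_cball by blast
  \<comment> \<open>A base point within \<open>r\<close> of \<open>z\<close>, moved by less than
    \<open>2 * r\<close>, stays in the ball of radius \<open>R\<close>; this leaves room for a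
    Cauchy circle of radius \<open>r\<close> around each parameter of modulus below
    \<open>r\<close>.\<close>
  define r where "r = R / 3"
  have r: "r > 0" using R by (simp add: r_def)
  have cont: "continuous_on S f" using f by (simp add: slice_holomorphic_def)
  have "compact (f ` cball z R)"
    by (intro compact_continuous_image continuous_on_subset[OF cont R(2)] compact_cball)
  then obtain M where M: "\<And>x. x \<in> cball z R \<Longrightarrow> norm (f x) \<le> M"
    using compact_imp_bounded[THEN iffD1[OF bounded_iff]] by (metis image_eqI)
  have M0: "M \<ge> 0" using order_trans[OF norm_ge_zero M[of z]] R by simp
  have key: "norm ((f (x + h *s axis i 1) - f x) / h - cpartial i f x) \<le> 2 * M / r\<^sup>2 * norm h"
    if x: "x \<in> ball z r" and h: "h \<noteq> 0" "norm h < r" for x h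
  proof -
    define g where "g s = f (x + s *s axis i 1)" for s
    have in_R: "x + s *s axis i 1 \<in> cball z R" if "norm s < 2 * r" for s
      using norm_line_le[of x s "axis i 1" z] that x
      by (simp add: dist_norm norm_minus_commute r_def)
    have hol: "g holomorphic_on ball 0 (2 * r)"
      unfolding g_def
      unfolding holomorphic_on_def
    proof
      fix s :: complex assume "s \<in> ball 0 (2 * r)"
      then have "x + s *s axis i 1 \<in> S" using in_R[of s] R(2) by auto
      from slice_holomorphic_line[OF f this]
      show "(\<lambda>s. f (x + s *s axis i 1)) field_differentiable at s within ball 0 (2 * r)"
        using field_differentiable_at_within field_differentiable_def by blast
    qed
    have bnd: "norm (g s) \<le> M" if "norm s < 2 * r" for s
      using M in_R that unfolding g_def by blast
    have d2: "norm ((deriv ^^ 2) g w) \<le> fact 2 * M / r ^ 2" if w: "norm w < r" for w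
    proof (rule Cauchy_inequality)
      have sub: "cball w r \<subseteq> ball 0 (2 * r)"
      proof
        fix y assume "y \<in> cball w r"
        then show "y \<in> ball 0 (2 * r)"
          using w norm_triangle_ineq[of w "y - w"] by (simp add: dist_norm norm_minus_commute)
      qed
      show "g holomorphic_on ball w r"
        using hol sub ball_subset_cball holomorphic_on_subset by blast
      show "continuous_on (cball w r) g"
        using hol sub holomorphic_on_imp_continuous_on holomorphic_on_subset by blast
      show "norm (g y) \<le> M" if "norm (w - y) = r" for y
      proof (rule bnd)
        show "norm y < 2 * r"
          using norm_triangle_ineq4[of w "w - y"] that w by simp
      qed
    qed (use r in auto)
    have "norm (g h - (\<Sum>k\<le>1. (deriv ^^ k) g 0 * (h - 0) ^ k / fact k))
        \<le> (2 * M / r\<^sup>2) * norm (h - 0) ^ Suc 1 / fact 1"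
    proof (rule complex_Taylor[of "ball 0 r" 1 "\<lambda>k. (deriv ^^ k) g" "2 * M / r\<^sup>2" 0 h, simplified funpow_0])
      show "((deriv ^^ k) g has_field_derivative (deriv ^^ Suc k) g y) (at y within ball 0 r)"
        if "y \<in> ball 0 r" for k y
      proof -
        have "(deriv ^^ k) g holomorphic_on ball 0 (2 * r)"
          by (rule holomorphic_higher_deriv[OF hol open_ball])
        moreover have "y \<in> ball 0 (2 * r)" using that r by auto
        ultimately show ?thesis
          by (simp add: holomorphic_derivI has_field_derivative_at_within)
      qed
      show "norm ((deriv ^^ Suc 1) g y) \<le> 2 * M / r\<^sup>2" if "y \<in> ball 0 r" for y
        using d2[of y] that by (simp add: numeral_2_eq_2)
    qed (use h r in auto)
    then have "norm (g h - g 0 - deriv g 0 * h) \<le> 2 * M / r\<^sup>2 * norm h * norm h"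
      by (simp add: power2_eq_square algebra_simps)
    moreover have "(g h - g 0) / h - deriv g 0 = (g h - g 0 - deriv g 0 * h) / h"
      using h by (simp add: field_simps)
    ultimately have "norm ((g h - g 0) / h - deriv g 0) \<le> 2 * M / r\<^sup>2 * norm h"
      using h by (simp add: norm_divide divide_le_eq)
    then show ?thesis
      by (simp add: g_def[abs_def] cpartial_def)
  qed
  show ?thesis
  proof (rule that[of r "2 * M / r\<^sup>2"])
    have "ball z (2 * r) \<subseteq> cball z R" using R(1) by (auto simp: r_def)
    then show "ball z (2 * r) \<subseteq> S" using R by blast
  qed (use r M0 key in auto)
qed

text \<open>Near \<open>z\<close> the function \<open>cpartial i f\<close> is a uniform limit of
  difference quotients that are continuous and differentiable along every line, and Weierstrass'
  theorem passes both properties to the limit. The second claim keeps the sequence of steps so that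
  \<open>cpartial_commute\<close> can evaluate the same limit in another way.\<close>

lemma slice_holomorphic_cpartial_aux:
  fixes f :: "complex ^ 'n::finite \<Rightarrow> complex"
  assumes S: "open S" and f: "slice_holomorphic f S" and z: "z \<in> S"
  shows "isCont (cpartial i f) z"
    and "\<exists>q :: nat \<Rightarrow> complex. q \<longlonglongrightarrow> 0 \<and> (\<forall>k. q k \<noteq> 0) \<and>
      (\<forall>j. (\<lambda>k. (cpartial j f (z + q k *s axis i 1) - cpartial j f z) / q k)
        \<longlonglongrightarrow> cpartial j (cpartial i f) z)"
    and "\<And>v. ((\<lambda>t. cpartial i f (z + t *s v)) has_field_derivative
        (\<Sum>j\<in>UNIV. v $ j * cpartial j (cpartial i f) z)) (at 0)"
proof -
  obtain r C where r: "r > 0" "C \<ge> 0" "ball z (2 * r) \<subseteq> S" and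
    bnd: "\<And>x h. x \<in> ball z r \<Longrightarrow> h \<noteq> 0 \<Longrightarrow> norm h < r \<Longrightarrow>
       norm ((f (x + h *s axis i 1) - f x) / h - cpartial i f x) \<le> C * norm h"
    using difference_quotient_bound[OF S f z] by blast
  \<comment> \<open>The shift by 2 makes every step, including that for \<open>k = 0\<close>,
    strictly shorter than \<open>r\<close>.\<close>
  define q :: "nat \<Rightarrow> complex" where "q k = of_real (r / (real k + 2))" for k
  have q0: "q k \<noteq> 0" for k
    using r by (simp add: q_def of_real_divide[symmetric] del: of_real_add of_real_divide)
  have nq: "norm (q k) = r / (real k + 2)" for k
    using r by (simp add: q_def del: of_real_add of_real_divide)
  have nqr: "norm (q k) < r" for k
    using r by (simp add: nq divide_less_eq)
  have "(\<lambda>k. r / (real k + 2)) \<longlonglongrightarrow> 0"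
    using LIMSEQ_ignore_initial_segment[OF lim_const_over_n[of r], of 2] by (simp add: add.commute)
  from tendsto_of_real[OF this] have qlim: "q \<longlonglongrightarrow> 0"
    unfolding q_def by (simp only: of_real_0)
  define Q where "Q k x = (f (x + q k *s axis i 1) - f x) / q k" for k x
  have unif: "uniform_limit (ball z r) Q (cpartial i f) sequentially"
    unfolding uniform_limit_iff
  proof (intro allI impI)
    fix e :: real assume e: "e > 0"
    have "(\<lambda>k. C * norm (q k)) \<longlonglongrightarrow> 0"
      using tendsto_mult_right_zero[OF tendsto_norm_zero[OF qlim]] .
    then have "\<forall>\<^sub>F k in sequentially. C * norm (q k) < e"
      using e by (simp add: order_tendstoD(2))
    then show "\<forall>\<^sub>F k in sequentially. \<forall>x\<in>ball z r. dist (Q k x) (cpartial i f x) < e"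
      by eventually_elim (use bnd q0 nqr in \<open>fastforce simp: dist_norm Q_def intro: le_less_trans\<close>)
  qed
  have in2: "x \<in> S" "x + q k *s axis i 1 \<in> S" if "x \<in> ball z r" for x k
  proof -
    have "ball z r \<subseteq> ball z (2 * r)" using r by (intro subset_ball) simp
    then show "x \<in> S" using that r by blast
    have "norm (x + q k *s axis i 1 - z) < 2 * r"
      using norm_line_le[of x "q k" "axis i 1" z] that nqr[of k]
      by (simp add: dist_norm norm_minus_commute)
    then show "x + q k *s axis i 1 \<in> S"
      using r by (auto simp: dist_norm norm_minus_commute)
  qed
  have contf: "continuous_on S f" using f by (simp add: slice_holomorphic_def)
  have contQ: "continuous_on (ball z r) (Q k)" for k
    unfolding Q_def
    by (intro continuous_intros continuous_on_compose2[OF contf] q0 ballI) (use in2 in auto)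
  have "continuous_on (ball z r) (cpartial i f)"
    by (rule uniform_limit_theorem[OF _ unif]) (simp_all add: contQ)
  then have cont: "isCont (cpartial i f) z"
    using r by (simp add: continuous_on_eq_continuous_at)
  \<comment> \<open>The limit of the derivatives of \<open>Q k\<close> along \<open>v\<close> is at
    first left unnamed. The choice \<open>v = axis j 1\<close> identifies it as a second partial
    derivative, and linearity in \<open>v\<close> then gives the general case.\<close>
  have dir: "\<exists>g'. ((\<lambda>t. cpartial i f (z + t *s v)) has_field_derivative g') (at 0) \<and>
     (\<lambda>k. \<Sum>j\<in>UNIV. v $ j * ((cpartial j f (z + q k *s axis i 1) - cpartial j f z) / q k)) \<longlonglongrightarrow> g'" for v
  proof -
    define T where "T = {t::complex. z + t *s v \<in> ball z r}"
    have T: "open T" "0 \<in> T"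
      using r open_line_preimage[OF open_ball, of z v z r] by (simp_all add: T_def)
    define g' where "g' k t = (\<Sum>j\<in>UNIV. v $ j *
        ((cpartial j f (z + t *s v + q k *s axis i 1) - cpartial j f (z + t *s v)) / q k))" for k t
    have "\<exists>h. \<forall>t\<in>T. ((\<lambda>t. cpartial i f (z + t *s v)) has_field_derivative h t) (at t) \<and>
        ((\<lambda>k. g' k t) \<longlongrightarrow> h t) sequentially"
    proof (rule has_complex_derivative_uniform_sequence[OF T(1)])
      show "((\<lambda>t. Q k (z + t *s v)) has_field_derivative g' k t) (at t)" if "t \<in> T" for k t
      proof -
        have zt: "z + t *s v \<in> ball z r" using that by (simp add: T_def)
        have eq: "z + s *s v + q k *s axis i 1 = (z + q k *s axis i 1) + s *s v" for s
          by (simp add: algebra_simps)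
        have "((\<lambda>t. f ((z + q k *s axis i 1) + t *s v)) has_field_derivative
           (\<Sum>j\<in>UNIV. v $ j * cpartial j f ((z + q k *s axis i 1) + t *s v))) (at t)"
          by (rule slice_holomorphic_line[OF f]) (use in2[OF zt] eq in metis)
        moreover have "((\<lambda>t. f (z + t *s v)) has_field_derivative
           (\<Sum>j\<in>UNIV. v $ j * cpartial j f (z + t *s v))) (at t)"
          by (rule slice_holomorphic_line[OF f]) (use in2[OF zt] in metis)
        ultimately have "((\<lambda>t. Q k (z + t *s v)) has_field_derivative
           ((\<Sum>j\<in>UNIV. v $ j * cpartial j f ((z + q k *s axis i 1) + t *s v)) -
            (\<Sum>j\<in>UNIV. v $ j * cpartial j f (z + t *s v))) / q k) (at t)"
          unfolding Q_def eq by (intro DERIV_cdivide DERIV_diff)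
        then show ?thesis
          unfolding g'_def eq
          by (simp add: sum_subtractf sum_divide_distrib right_diff_distrib diff_divide_distrib
              del: sum_axis_mult)
      qed
      show "\<exists>d>0. cball t d \<subseteq> T \<and> uniform_limit (cball t d) (\<lambda>k t. Q k (z + t *s v))
          (\<lambda>t. cpartial i f (z + t *s v)) sequentially" if t: "t \<in> T" for t
      proof -
        obtain d where d: "d > 0" "cball t d \<subseteq> T" using t T(1) unfolding open_contains_cball by blast
        have "uniform_limit (cball t d) (\<lambda>k t. Q k (z + t *s v)) (\<lambda>t. cpartial i f (z + t *s v)) sequentially"
          by (rule uniform_limit_compose'[OF unif]) (use d in \<open>auto simp: T_def\<close>)
        then show ?thesis using d by blast
      qed
    qed
    then obtain h where "\<forall>t\<in>T. ((\<lambda>t. cpartial i f (z + t *s v)) has_field_derivative h t) (at t) \<and>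
        ((\<lambda>k. g' k t) \<longlongrightarrow> h t) sequentially" ..
    from bspec[OF this T(2)] have h: "((\<lambda>t. cpartial i f (z + t *s v)) has_field_derivative h 0) (at 0)"
      "(\<lambda>k. g' k 0) \<longlonglongrightarrow> h 0"
      by simp_all
    then show ?thesis unfolding g'_def by auto
  qed
  have lim: "(\<lambda>k. (cpartial j f (z + q k *s axis i 1) - cpartial j f z) / q k) \<longlonglongrightarrow> cpartial j (cpartial i f) z" for j
  proof -
    obtain g' where "((\<lambda>t. cpartial i f (z + t *s axis j 1)) has_field_derivative g') (at 0)"
      "(\<lambda>k. (cpartial j f (z + q k *s axis i 1) - cpartial j f z) / q k) \<longlonglongrightarrow> g'"
      using dir[of "axis j 1"] unfolding sum_axis_mult by blast
    then show ?thesis using cpartial_eqI by blast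
  qed
  show "isCont (cpartial i f) z" by (fact cont)
  show "\<exists>q :: nat \<Rightarrow> complex. q \<longlonglongrightarrow> 0 \<and> (\<forall>k. q k \<noteq> 0) \<and>
      (\<forall>j. (\<lambda>k. (cpartial j f (z + q k *s axis i 1) - cpartial j f z) / q k)
        \<longlonglongrightarrow> cpartial j (cpartial i f) z)"
    using qlim q0 lim by (intro exI[of _ q]) simp
  show "((\<lambda>t. cpartial i f (z + t *s v)) has_field_derivative
      (\<Sum>j\<in>UNIV. v $ j * cpartial j (cpartial i f) z)) (at 0)" for v
  proof -
    obtain g' where g': "((\<lambda>t. cpartial i f (z + t *s v)) has_field_derivative g') (at 0)"
     "(\<lambda>k. \<Sum>j\<in>UNIV. v $ j * ((cpartial j f (z + q k *s axis i 1) - cpartial j f z) / q k)) \<longlonglongrightarrow> g'"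
      using dir by blast
    have "(\<lambda>k. \<Sum>j\<in>UNIV. v $ j * ((cpartial j f (z + q k *s axis i 1) - cpartial j f z) / q k))
       \<longlonglongrightarrow> (\<Sum>j\<in>UNIV. v $ j * cpartial j (cpartial i f) z)"
      by (intro tendsto_intros lim)
    from g'(1)[unfolded LIMSEQ_unique[OF g'(2) this]] show ?thesis .
  qed
qed

lemma slice_holomorphic_cpartial:
  assumes "open S" "slice_holomorphic f S"
  shows "slice_holomorphic (cpartial i f) S"
  unfolding slice_holomorphic_def
proof (intro conjI ballI allI)
  show "continuous_on S (cpartial i f)"
    using slice_holomorphic_cpartial_aux(1)[OF assms] by (intro continuous_at_imp_continuous_on) simp
next
  fix z v assume "z \<in> S"
  from slice_holomorphic_cpartial_aux(3)[OF assms this, of i v] show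
    "((\<lambda>t. cpartial i f (z + t *s v)) has_field_derivative
        (\<Sum>j\<in>UNIV. v $ j * cpartial j (cpartial i f) z)) (at 0)" .
qed

text \<open>The difference quotients of \<open>cpartial j f\<close> in direction \<open>i\<close>
  converge to one mixed derivative by \<open>slice_holomorphic_cpartial_aux\<close> and to the other
  by the definition of the derivative.\<close>

lemma cpartial_commute:
  assumes "open S" "slice_holomorphic f S" "z \<in> S"
  shows "cpartial j (cpartial i f) z = cpartial i (cpartial j f) z"
proof -
  obtain q :: "nat \<Rightarrow> complex" where q: "q \<longlonglongrightarrow> 0" "\<And>k. q k \<noteq> 0" and
    lim: "\<And>j. (\<lambda>k. (cpartial j f (z + q k *s axis i 1) - cpartial j f z) / q k) \<longlonglongrightarrow> cpartial j (cpartial i f) z"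
    using slice_holomorphic_cpartial_aux(2)[OF assms, of i] by auto
  have "((\<lambda>t. cpartial j f (z + t *s axis i 1)) has_field_derivative cpartial i (cpartial j f) z) (at 0)"
    using slice_holomorphic_axis[OF slice_holomorphic_cpartial[OF assms(1,2)] assms(3)] .
  then have "((\<lambda>h. (cpartial j f (z + h *s axis i 1) - cpartial j f z) / h) \<longlongrightarrow>
      cpartial i (cpartial j f) z) (at 0)"
    by (simp add: DERIV_def)
  moreover have "filterlim q (at 0) sequentially"
    using q by (simp add: filterlim_at)
  ultimately have "(\<lambda>k. (cpartial j f (z + q k *s axis i 1) - cpartial j f z) / q k) \<longlonglongrightarrow>
      cpartial i (cpartial j f) z"
    by (rule filterlim_compose)
  then show ?thesis using lim LIMSEQ_unique by blast
qed

section \<open>Derivative estimates and the maximum principle in the disc and the polydisc\<close>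

text \<open>Cauchy's formula on the image of the circle of radius \<open>1/2\<close> under the disc automorphism
  taking \<open>0\<close> to \<open>t\<close>; a Euclidean circle would only give the constant \<open>4\<close>.\<close>
lemma deriv_bound_weighted_disc:
  fixes f :: "complex \<Rightarrow> complex"
  assumes hol: "f holomorphic_on ball 0 1"
    and bnd: "\<And>s. norm s < 1 \<Longrightarrow> norm (f s) \<le> m / (1 - (norm s)\<^sup>2)"
    and t: "0 \<le> t" "t < 1"
  shows "norm (deriv f (of_real t)) \<le> 10 / 3 * m / (1 - t\<^sup>2)\<^sup>2"
proof -
  define \<phi> :: "complex \<Rightarrow> complex" where "\<phi> s = (s + of_real t) / (1 + of_real t * s)" for s
  have t2: "0 < 1 - t\<^sup>2"
    using t by (simp add: power_less_one_iff)
  have den: "1 + of_real t * s \<noteq> (0::complex)" if "norm s < 1" for s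
  proof
    assume "1 + of_real t * s = 0"
    then have "of_real t * s = -1" by (simp add: add_eq_0_iff)
    then have "t * norm s = 1" using t by (metis norm_minus_cancel norm_mult norm_of_real norm_one abs_of_nonneg)
    moreover have "t * norm s < 1" using that t mult_strict_mono'[of t 1 "norm s" 1] by simp
    ultimately show False by simp
  qed
  \<comment> \<open>This is how the weight \<open>1 - |s|^2\<close> transforms under a disc
    automorphism; it makes the growth bound for \<open>f\<close> explicit after composition with
    \<open>\<phi>\<close>.\<close>
  have one_minus: "1 - (norm (\<phi> s))\<^sup>2 = (1 - t\<^sup>2) * (1 - (norm s)\<^sup>2) / (norm (1 + of_real t * s))\<^sup>2"
    if "norm s < 1" for s
  proof -
    have "(norm (1 + of_real t * s))\<^sup>2 - (norm (s + of_real t))\<^sup>2 = (1 - t\<^sup>2) * (1 - (norm s)\<^sup>2)"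
      unfolding cmod_power2 by (simp add: power2_eq_square algebra_simps)
    then show ?thesis
      using den[OF that] by (simp add: \<phi>_def norm_divide power_divide field_simps)
  qed
  have \<phi>1: "norm (\<phi> s) < 1" if "norm s < 1" for s
  proof -
    have "0 < 1 - (norm s)\<^sup>2" using that by (simp add: power_less_one_iff)
    then have "0 < 1 - (norm (\<phi> s))\<^sup>2"
      using one_minus[OF that] den[OF that] t2 by simp
    then show ?thesis by (simp add: power_less_one_iff abs_square_less_1)
  qed
  have \<phi>': "(\<phi> has_field_derivative (1 - of_real (t\<^sup>2))) (at 0)"
    unfolding \<phi>_def by (rule derivative_eq_intros refl | simp add: power2_eq_square)+
  have hol\<phi>: "\<phi> holomorphic_on ball 0 1"
    unfolding \<phi>_def by (intro holomorphic_intros) (use den in auto)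
  define G where "G = f \<circ> \<phi>"
  have holG: "G holomorphic_on ball 0 1"
    unfolding G_def by (rule holomorphic_on_compose_gen[OF hol\<phi> hol]) (use \<phi>1 in auto)
  have "(f has_field_derivative deriv f (of_real t)) (at (\<phi> 0))"
    using holomorphic_derivI[OF hol open_ball, of "of_real t"] t by (simp add: \<phi>_def)
  from DERIV_imp_deriv[OF DERIV_chain[OF this \<phi>']]
  have G': "deriv G 0 = deriv f (of_real t) * (1 - of_real (t\<^sup>2))"
    by (simp add: G_def)
  \<comment> \<open>On \<open>|s| = 1/2\<close> the weight \<open>1 - |s|^2\<close> is
    \<open>3/4\<close>. The term with \<open>Re s\<close> is kept rather than estimated because its
    mean over the circle is zero.\<close>
  have Gb: "norm (G s) \<le> 4 * m / (3 * (1 - t\<^sup>2)) * (1 + t\<^sup>2 / 4 + 2 * t * Re s)" if s: "norm s = 1 / 2" for s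
  proof -
    have "norm (G s) \<le> m / (1 - (norm (\<phi> s))\<^sup>2)"
      using bnd \<phi>1 s by (simp add: G_def)
    also have "\<dots> = 4 * m / (3 * (1 - t\<^sup>2)) * (norm (1 + of_real t * s))\<^sup>2"
    proof -
      have "(norm s)\<^sup>2 = 1 / 4" by (simp add: s power2_eq_square)
      then have eq: "1 - (norm (\<phi> s))\<^sup>2 = (1 - t\<^sup>2) * (3 / 4) / (norm (1 + of_real t * s))\<^sup>2"
        using one_minus[of s] s by (simp add: power2_eq_square)
      show ?thesis
        unfolding eq using t2 den[of s] s by (simp add: field_simps)
    qed
    also have "(norm (1 + of_real t * s))\<^sup>2 = 1 + t\<^sup>2 / 4 + 2 * t * Re s"
    proof -
      have "(norm (1 + of_real t * s))\<^sup>2 = 1 + t\<^sup>2 * (norm s)\<^sup>2 + 2 * t * Re s"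
        unfolding cmod_power2 by (simp add: power2_eq_square algebra_simps)
      then show ?thesis by (simp add: s power2_eq_square)
    qed
    finally show ?thesis .
  qed
  let ?c = "circlepath 0 (1/2)"
  have cont: "continuous_on (cball 0 (1/2)) G"
    by (rule holomorphic_on_imp_continuous_on[OF holomorphic_on_subset[OF holG]]) auto
  have holG2: "G holomorphic_on ball 0 (1/2)"
    by (rule holomorphic_on_subset[OF holG]) auto
  have "((\<lambda>u. G u / (u - 0) ^ Suc 1) has_contour_integral
       ((2 * pi * \<i>) / fact 1 * (deriv ^^ 1) G 0)) ?c"
    by (rule Cauchy_has_contour_integral_higher_derivative_circlepath[OF cont holG2]) simp
  then have int: "((\<lambda>x. G (?c x) / (?c x)\<^sup>2 * vector_derivative ?c (at x within {0..1})) has_integral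
       (2 * pi * \<i> * deriv G 0)) {0..1}"
    by (simp add: has_contour_integral_def power2_eq_square)
  \<comment> \<open>A majorant of the Cauchy integrand: the factor \<open>4 * pi\<close> is
    \<open>2 * pi * |s| / |s|^2\<close> for \<open>|s| = 1/2\<close>, and \<open>2 * Re s\<close>
    has become the cosine.\<close>
  define g where "g x = 4 * pi * (4 * m / (3 * (1 - t\<^sup>2)) * (1 + t\<^sup>2 / 4 + t * cos (2 * pi * x)))" for x
  have "((\<lambda>x. cos (2 * pi * x)) has_integral (sin (2 * pi * 1) / (2 * pi) - sin (2 * pi * 0) / (2 * pi))) {0..1}"
    by (rule fundamental_theorem_of_calculus)
      (auto intro!: derivative_eq_intros simp: has_real_derivative_iff_has_vector_derivative[symmetric])
  then have "((\<lambda>x. cos (2 * pi * x)) has_integral 0) {0..1}" by simp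
  from has_integral_add[OF has_integral_const_real[of "1 + t\<^sup>2 / 4" 0 1] has_integral_mult_right[OF this, of t]]
  have "((\<lambda>x. 1 + t\<^sup>2 / 4 + t * cos (2 * pi * x)) has_integral (1 + t\<^sup>2 / 4)) {0..1}"
    by simp
  from has_integral_mult_right[OF has_integral_mult_right[OF this, of "4 * m / (3 * (1 - t\<^sup>2))"], of "4 * pi"]
  have gint: "(g has_integral (4 * pi * (4 * m / (3 * (1 - t\<^sup>2)) * (1 + t\<^sup>2 / 4)))) {0..1}"
    unfolding g_def[abs_def] .
  have "norm (2 * pi * \<i> * deriv G 0) \<le> 4 * pi * (4 * m / (3 * (1 - t\<^sup>2)) * (1 + t\<^sup>2 / 4))"
  proof -
    have "norm (integral {0..1} (\<lambda>x. G (?c x) / (?c x)\<^sup>2 * vector_derivative ?c (at x within {0..1})))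
        \<le> integral {0..1} g"
    proof (rule integral_norm_bound_integral)
      fix x :: real assume x: "x \<in> {0..1}"
      have vd: "vector_derivative ?c (at x within {0..1}) = 2 * pi * \<i> * ?c x"
        using x by (subst vector_derivative_circlepath01) (simp_all add: circlepath)
      have nc: "norm (?c x) = 1 / 2"
        by (simp add: circlepath norm_mult)
      have re: "Re (?c x) = cos (2 * pi * x) / 2"
        by (simp add: circlepath Re_exp)
      have "norm (G (?c x) / (?c x)\<^sup>2 * vector_derivative ?c (at x within {0..1})) = 4 * pi * norm (G (?c x))"
      proof -
        have "?c x \<noteq> 0" using nc by auto
        then show ?thesis
          unfolding vd by (simp add: norm_mult norm_divide norm_power nc power2_eq_square)
      qed
      also have "\<dots> \<le> g x"
        using mult_left_mono[OF Gb[OF nc], of "4 * pi"] by (simp add: g_def re)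
      finally show "norm (G (?c x) / (?c x)\<^sup>2 * vector_derivative ?c (at x within {0..1})) \<le> g x" .
    qed (use int gint in \<open>auto simp: has_integral_integrable\<close>)
    then show ?thesis
      using int gint by (simp add: integral_unique)
  qed
  moreover have "norm (2 * pi * \<i> * deriv G 0) = 2 * pi * norm (deriv G 0)"
    by (simp add: norm_mult)
  moreover have "4 * pi * K = 2 * pi * (2 * K)" for K :: real by simp
  ultimately have "2 * pi * norm (deriv G 0) \<le> 2 * pi * (2 * (4 * m / (3 * (1 - t\<^sup>2)) * (1 + t\<^sup>2 / 4)))"
    by (simp only:)
  then have "norm (deriv G 0) \<le> 2 * (4 * m / (3 * (1 - t\<^sup>2)) * (1 + t\<^sup>2 / 4))"
    by (rule mult_left_le_imp_le) simp
  \<comment> \<open>The constant \<open>10 / 3\<close> arises as \<open>2 * (4/3) * (5/4)\<close>,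
    with \<open>1 + t^2 / 4\<close> bounded by \<open>5/4\<close>.\<close>
  also have "\<dots> \<le> 2 * (4 * m / (3 * (1 - t\<^sup>2)) * (5 / 4))"
  proof -
    have "0 \<le> m" using order_trans[OF norm_ge_zero bnd[of 0]] by simp
    then show ?thesis using t2 by (intro mult_left_mono) auto
  qed
  also have "2 * (4 * m / (3 * (1 - t\<^sup>2)) * (5 / 4)) = 10 / 3 * m / (1 - t\<^sup>2)"
    using t2 by (simp add: divide_simps)
  also have "deriv G 0 = deriv f (of_real t) * of_real (1 - t\<^sup>2)"
    using G' by simp
  also have "norm \<dots> = norm (deriv f (of_real t)) * (1 - t\<^sup>2)"
    unfolding norm_mult norm_of_real using t2 by simp
  finally have "norm (deriv f (of_real t)) * (1 - t\<^sup>2) \<le> 10 / 3 * m / (1 - t\<^sup>2)" .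
  then have "norm (deriv f (of_real t)) \<le> 10 / 3 * m / (1 - t\<^sup>2) / (1 - t\<^sup>2)"
    by (simp only: pos_le_divide_eq[OF t2])
  then show ?thesis by (simp only: power2_eq_square divide_divide_eq_left)
qed

text \<open>The maximum principle in one variable is applied to one coordinate after another, which
  moves the point to the distinguished boundary.\<close>

lemma polydisc_max_modulus:
  fixes f :: "complex ^ 'n::finite \<Rightarrow> complex"
  assumes f: "slice_holomorphic f polydisc" and r: "0 \<le> r" "r < 1"
    and torus: "\<And>w. (\<And>i. norm (w $ i) = r) \<Longrightarrow> norm (f w) \<le> M"
    and z: "\<And>i. norm (z $ i) \<le> r"
  shows "norm (f z) \<le> M"
proof (cases "r = 0")
  case True
  then show ?thesis using torus z by (simp add: order_antisym)
next
  case False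
  \<comment> \<open>\<open>S\<close> contains the coordinates that may still lie inside the circle
    of radius \<open>r\<close>; each induction step pushes one of them onto it.\<close>
  have "\<forall>z. (\<forall>i. norm (z $ i) \<le> r) \<and> (\<forall>i. i \<notin> S \<longrightarrow> norm (z $ i) = r) \<longrightarrow> norm (f z) \<le> M"
    if "finite S" for S
    using that
  proof (induction S rule: finite_induct)
    case empty
    then show ?case using torus by auto
  next
    case (insert k S)
    show ?case
    proof (intro allI impI)
      fix z :: "complex ^ 'n"
      assume z: "(\<forall>i. norm (z $ i) \<le> r) \<and> (\<forall>i. i \<notin> insert k S \<longrightarrow> norm (z $ i) = r)"
      define z' where "z' = z - z $ k *s axis k 1"
      have comp: "(z' + s *s axis k 1) $ i = (if i = k then s else z $ i)" for s i
        by (simp add: z'_def axis_def)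
      have in_poly: "z' + s *s axis k 1 \<in> polydisc" if "norm s \<le> r" for s
        unfolding polydisc_def mem_Collect_eq comp using that z r by (auto intro: le_less_trans)
      have der: "((\<lambda>s. f (z' + s *s axis k 1)) has_field_derivative
          (\<Sum>j\<in>UNIV. axis k 1 $ j * cpartial j f (z' + s *s axis k 1))) (at s)" if "norm s \<le> r" for s
        by (rule slice_holomorphic_line[OF f in_poly[OF that]])
      have "norm (f (z' + z $ k *s axis k 1)) \<le> M"
      proof (rule maximum_modulus_frontier[of "\<lambda>s. f (z' + s *s axis k 1)" "cball 0 r"])
        show "(\<lambda>s. f (z' + s *s axis k 1)) holomorphic_on interior (cball 0 r)"
          unfolding holomorphic_on_def field_differentiable_def
        proof (intro ballI exI)
          fix s :: complex assume "s \<in> interior (cball 0 r)"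
          then have "norm s \<le> r" by simp
          from has_field_derivative_at_within[OF der[OF this]]
          show "((\<lambda>s. f (z' + s *s axis k 1)) has_field_derivative
            (\<Sum>j\<in>UNIV. axis k 1 $ j * cpartial j f (z' + s *s axis k 1))) (at s within interior (cball 0 r))" .
        qed
        have "isCont (\<lambda>s. f (z' + s *s axis k 1)) s" if "norm s \<le> r" for s
          using der[OF that] by (rule DERIV_isCont)
        then show "continuous_on (closure (cball 0 r)) (\<lambda>s. f (z' + s *s axis k 1))"
          by (auto intro!: continuous_at_imp_continuous_on)
        show "norm (f (z' + s *s axis k 1)) \<le> M" if "s \<in> frontier (cball 0 r)" for s
        proof -
          have s: "norm s = r" using that by simp
          have "(\<forall>i. norm ((z' + s *s axis k 1) $ i) \<le> r) \<and>
              (\<forall>i. i \<notin> S \<longrightarrow> norm ((z' + s *s axis k 1) $ i) = r)"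
            unfolding comp using z s by auto
          then show ?thesis using insert.IH by blast
        qed
      qed (use z in auto)
      then show "norm (f z) \<le> M" by (simp add: z'_def)
    qed
  qed
  from this[of UNIV] show ?thesis using z by simp
qed

text \<open>The Schwarz lemma on an analytic disc through \<open>z\<close> in direction \<open>e\<close> whose coordinates
  are disc automorphisms scaled by \<open>R\<close>.\<close>
lemma polydisc_deriv_bound:
  fixes f :: "complex ^ 'n::finite \<Rightarrow> complex"
  assumes f: "holomorphic_cn f polydisc" and t: "0 \<le> t" "t < R" "R < 1"
    and bnd: "\<And>w. (\<And>i. norm (w $ i) \<le> R) \<Longrightarrow> norm (f w) \<le> M"
    and z: "\<And>i. norm (z $ i) \<le> t" and e: "\<And>i. norm (e $ i) \<le> E" "E > 0"
  shows "norm (\<Sum>j\<in>UNIV. e $ j * cpartial j f z) \<le> M * E * R / (R\<^sup>2 - t\<^sup>2)"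
proof -
  have R: "R > 0" using t by simp
  have Rt: "0 < R\<^sup>2 - t\<^sup>2" using t by (simp add: power_strict_mono)
  \<comment> \<open>The largest factor for which \<open>norm (l i) \<le> 1\<close> is guaranteed:
    the worst case is \<open>norm (e $ i) = E\<close> together with
    \<open>norm (z $ i) = t\<close>.\<close>
  define \<kappa> where "\<kappa> = (R\<^sup>2 - t\<^sup>2) / (R * E)"
  have \<kappa>: "\<kappa> > 0" using R Rt e(2) by (simp add: \<kappa>_def)
  have Rz: "R\<^sup>2 - t\<^sup>2 \<le> R\<^sup>2 - (norm (z $ i))\<^sup>2" for i
    using z[of i] by (simp add: power_mono)
  define a where "a i = z $ i / of_real R" for i
  define l where "l i = e $ i * of_real (\<kappa> * R / (R\<^sup>2 - (norm (z $ i))\<^sup>2))" for i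
  have a1: "norm (a i) < 1" for i
    using z[of i] t by (simp add: a_def norm_divide divide_less_eq)
  have l1: "norm (l i) \<le> 1" for i
  proof -
    have p: "0 < R\<^sup>2 - (norm (z $ i))\<^sup>2" using Rz[of i] Rt by linarith
    have "norm (l i) = norm (e $ i) * (\<kappa> * R / (R\<^sup>2 - (norm (z $ i))\<^sup>2))"
    proof -
      have "0 \<le> \<kappa> * R / (R\<^sup>2 - (norm (z $ i))\<^sup>2)"
        by (rule less_imp_le[OF divide_pos_pos[OF mult_pos_pos[OF \<kappa> R] p]])
      then show ?thesis unfolding l_def norm_mult norm_of_real by (simp only: abs_of_nonneg)
    qed
    also have "\<dots> \<le> E * (\<kappa> * R / (R\<^sup>2 - (norm (z $ i))\<^sup>2))"
      by (rule mult_right_mono[OF e(1) less_imp_le[OF divide_pos_pos[OF mult_pos_pos[OF \<kappa> R] p]]])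
    also have "\<dots> = (R\<^sup>2 - t\<^sup>2) / (R\<^sup>2 - (norm (z $ i))\<^sup>2)"
      using R e(2) by (simp add: \<kappa>_def)
    also have "\<dots> \<le> 1" using p Rz[of i] by simp
    finally show ?thesis .
  qed
  define N where "N i s = l i * s + a i" for i s
  define D where "D i s = 1 + cnj (a i) * l i * s" for i s
  have ls: "norm (l i * s) \<le> 1" if "norm s \<le> 1" for i s
    using l1[of i] that by (simp add: norm_mult mult_le_one)
  have D0: "D i s \<noteq> 0" if "norm s \<le> 1" for i s
  proof
    assume "D i s = 0"
    then have "cnj (a i) * (l i * s) = -1" by (simp add: D_def add_eq_0_iff mult.assoc)
    then have "norm (a i) * norm (l i * s) = 1"
      by (metis complex_mod_cnj norm_minus_cancel norm_mult norm_one)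
    moreover have "norm (a i) * norm (l i * s) \<le> norm (a i) * 1"
      using ls[OF that] by (intro mult_left_mono) auto
    ultimately show False using a1[of i] by simp
  qed
  \<comment> \<open>Each coordinate is \<open>R\<close> times the disc automorphism that takes 0 to
    \<open>a i\<close>, evaluated at \<open>l i * s\<close>. It sends 0 to \<open>z $ i\<close>, and
    \<open>l i\<close> is chosen so that its derivative there is
    \<open>\<kappa> * e $ i\<close>.\<close>
  define \<psi> where "\<psi> s = (\<chi> i. of_real R * N i s / D i s)" for s
  have \<psi>R: "norm (\<psi> s $ i) \<le> R" if "norm s \<le> 1" for s i
  proof -
    let ?w = "l i * s"
    have "(norm (1 + cnj (a i) * ?w))\<^sup>2 - (norm (?w + a i))\<^sup>2 = (1 - (norm (a i))\<^sup>2) * (1 - (norm ?w)\<^sup>2)"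
      unfolding cmod_power2 by (simp add: power2_eq_square algebra_simps)
    also have "\<dots> \<ge> 0"
      using ls[OF that, of i] a1[of i] by (simp add: power_le_one)
    finally have "(norm (?w + a i))\<^sup>2 \<le> (norm (1 + cnj (a i) * ?w))\<^sup>2" by simp
    then have "norm (?w + a i) \<le> norm (1 + cnj (a i) * ?w)"
      by (rule power2_le_imp_le) simp
    then have "norm (N i s) \<le> norm (D i s)"
      by (simp add: N_def D_def mult.assoc)
    then show ?thesis
      using D0[OF that, of i] R by (simp add: \<psi>_def norm_mult norm_divide divide_le_eq)
  qed
  define g where "g = f \<circ> \<psi>"
  define \<psi>' where "\<psi>' s = (\<chi> i. of_real R * (l i * D i s - N i s * (cnj (a i) * l i)) / (D i s)\<^sup>2)" for s
  have der\<psi>: "(\<psi> has_derivative (\<lambda>h. h *s \<psi>' s)) (at s)" if s: "norm s \<le> 1" for s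
  proof -
    have "((\<lambda>s. of_real R * N i s / D i s) has_field_derivative \<psi>' s $ i) (at s)" for i
      unfolding N_def D_def \<psi>'_def
      by (rule derivative_eq_intros refl | use D0[OF s, of i] in \<open>simp add: D_def power2_eq_square algebra_simps\<close>)+
    then have "((\<lambda>s. \<chi> i. of_real R * N i s / D i s) has_derivative (\<lambda>h. \<chi> i. \<psi>' s $ i * h)) (at s)"
      unfolding has_field_derivative_def by (rule has_derivative_vec_lambda)
    moreover have "(\<lambda>h. \<chi> i. \<psi>' s $ i * h) = (\<lambda>h. h *s \<psi>' s)"
      by (simp add: vec_eq_iff fun_eq_iff mult.commute)
    ultimately show ?thesis unfolding \<psi>_def[abs_def] by simp
  qed
  have \<psi>0: "\<psi> 0 = z"
    using R by (simp add: \<psi>_def N_def D_def a_def vec_eq_iff)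
  have \<psi>'0: "\<psi>' 0 = of_real \<kappa> *s e"
  proof -
    have "of_real R * (l i - a i * (cnj (a i) * l i)) = of_real \<kappa> * e $ i" for i
    proof -
      have p: "R\<^sup>2 - (norm (z $ i))\<^sup>2 \<noteq> 0" using Rz[of i] Rt by linarith
      have "a i * cnj (a i) = of_real ((norm (a i))\<^sup>2)"
        by (simp add: complex_norm_square[symmetric])
      then have "of_real R * (l i - a i * (cnj (a i) * l i)) = of_real (R * (1 - (norm (a i))\<^sup>2)) * l i"
        by (simp add: algebra_simps)
      also have "\<dots> = of_real (R * (1 - (norm (a i))\<^sup>2) * (\<kappa> * R / (R\<^sup>2 - (norm (z $ i))\<^sup>2))) * e $ i"
        by (simp only: l_def of_real_mult mult_ac)
      also have "R * (1 - (norm (a i))\<^sup>2) * (\<kappa> * R / (R\<^sup>2 - (norm (z $ i))\<^sup>2)) = \<kappa>"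
        using R p by (simp add: a_def norm_divide power_divide power2_eq_square divide_simps)
      finally show ?thesis .
    qed
    then show ?thesis by (simp add: \<psi>'_def N_def D_def vec_eq_iff)
  qed
  have derg: "(g has_field_derivative (\<Sum>j\<in>UNIV. \<psi>' s $ j * cpartial j f (\<psi> s))) (at s)"
    if s: "norm s \<le> 1" for s
  proof -
    have "\<psi> s \<in> polydisc"
      using \<psi>R[OF s] t by (auto simp: polydisc_def intro: le_less_trans)
    then obtain D' where D': "(f has_derivative D') (at (\<psi> s))" and lin: "\<And>c v. D' (c *s v) = c * D' v"
      using f unfolding holomorphic_cn_def by blast
    have "(f \<circ> \<psi> has_derivative D' \<circ> (\<lambda>h. h *s \<psi>' s)) (at s)"
      by (rule diff_chain_at[OF der\<psi>[OF s] D'])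
    then have 1: "(g has_field_derivative D' (\<psi>' s)) (at s)"
      by (simp add: has_field_derivative_def g_def o_def lin mult.commute[of _ "D' _"])
    \<comment> \<open>The disc \<open>\<psi>\<close> is curved. Its tangent line gives the same
      derivative of \<open>f\<close>, and on a line slice holomorphy expresses it by partial
      derivatives.\<close>
    have "(f \<circ> (\<lambda>t. \<psi> s + t *s \<psi>' s) has_derivative D' \<circ> (\<lambda>h. h *s \<psi>' s)) (at 0)"
      by (rule diff_chain_at[OF smult_line_has_derivative]) (simp add: D')
    then have "((\<lambda>t. f (\<psi> s + t *s \<psi>' s)) has_field_derivative D' (\<psi>' s)) (at 0)"
      by (simp add: has_field_derivative_def o_def lin mult.commute[of _ "D' _"])
    moreover have "((\<lambda>t. f (\<psi> s + t *s \<psi>' s)) has_field_derivative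
        (\<Sum>j\<in>UNIV. \<psi>' s $ j * cpartial j f (\<psi> s))) (at 0)"
      using holomorphic_cn_imp_slice_holomorphic[OF f] \<open>\<psi> s \<in> polydisc\<close>
      unfolding slice_holomorphic_def by blast
    ultimately show ?thesis using 1 DERIV_unique by metis
  qed
  have "norm ((deriv ^^ 1) g 0) \<le> fact 1 * M / 1 ^ 1"
  proof (rule Cauchy_inequality)
    show "g holomorphic_on ball 0 1"
      unfolding holomorphic_on_def field_differentiable_def
    proof (intro ballI exI)
      fix s :: complex assume "s \<in> ball 0 1"
      then have "norm s \<le> 1" by simp
      from has_field_derivative_at_within[OF derg[OF this]]
      show "(g has_field_derivative (\<Sum>j\<in>UNIV. \<psi>' s $ j * cpartial j f (\<psi> s))) (at s within ball 0 1)" .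
    qed
    have "isCont g s" if "norm s \<le> 1" for s
      using derg[OF that] by (rule DERIV_isCont)
    then show "continuous_on (cball 0 1) g"
      by (auto intro!: continuous_at_imp_continuous_on)
    show "norm (g s) \<le> M" if "norm (0 - s) = 1" for s
      using that \<psi>R bnd by (simp add: g_def)
  qed simp
  moreover have "deriv g 0 = of_real \<kappa> * (\<Sum>j\<in>UNIV. e $ j * cpartial j f z)"
    using DERIV_imp_deriv[OF derg[of 0]] by (simp add: \<psi>0 \<psi>'0 sum_distrib_left mult.assoc)
  ultimately have "\<kappa> * norm (\<Sum>j\<in>UNIV. e $ j * cpartial j f z) \<le> M"
    using \<kappa> by (simp add: norm_mult)
  then have "norm (\<Sum>j\<in>UNIV. e $ j * cpartial j f z) \<le> M / \<kappa>"
    using \<kappa> by (simp add: pos_le_divide_eq mult.commute)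
  then show ?thesis by (simp add: \<kappa>_def mult_ac)
qed

subsection \<open>Differential inequalities on a ray\<close>

text \<open>Real induction: at the infimum of the points where \<open>P\<close> fails,
  \<open>left\<close> yields \<open>P\<close> and \<open>right\<close> extends it beyond, a
  contradiction.\<close>

lemma interval_induction:
  fixes a b :: real
  assumes start: "P a"
    and left: "\<And>t. a < t \<Longrightarrow> t < b \<Longrightarrow> (\<And>s. a \<le> s \<Longrightarrow> s < t \<Longrightarrow> P s) \<Longrightarrow> P t"
    and right: "\<And>t. a \<le> t \<Longrightarrow> t < b \<Longrightarrow> P t \<Longrightarrow> \<forall>\<^sub>F s in at_right t. P s"
    and t: "a \<le> t" "t < b"
  shows "P t"
proof (rule ccontr)
  assume "\<not> P t"
  define B where "B = {s. a \<le> s \<and> s < b \<and> \<not> P s}"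
  define m where "m = Inf B"
  have tB: "t \<in> B" using t \<open>\<not> P t\<close> by (simp add: B_def)
  have bdd: "bdd_below B" by (auto simp: B_def intro: bdd_belowI[of _ a])
  have lower: "m \<le> s" if "s \<in> B" for s
    unfolding m_def by (rule cInf_lower[OF that bdd])
  have "a \<le> m"
    unfolding m_def by (rule cInf_greatest) (use tB in \<open>auto simp: B_def\<close>)
  moreover have "m < b" using lower[OF tB] t by simp
  ultimately have m: "a \<le> m" "m < b" by auto
  have less: "P s" if "a \<le> s" "s < m" for s
  proof (rule ccontr)
    assume "\<not> P s"
    then have "s \<in> B" using that m by (simp add: B_def)
    from lower[OF this] that show False by simp
  qed
  have Pm: "P m"
  proof (cases "m = a")
    case False
    then show ?thesis using left[of m] less m by auto
  qed (use start in simp)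
  then obtain c where c: "c > m" "\<And>s. m < s \<Longrightarrow> s < c \<Longrightarrow> P s"
    using right[OF m] by (auto simp: eventually_at_right_field)
  obtain s where s: "s \<in> B" "s < c"
    using cInf_lessD[of B c] c(1) tB unfolding m_def by blast
  have "\<not> P s" using s(1) by (simp add: B_def)
  then show False using c(2)[of s] s(2) lower[OF s(1)] Pm by (cases "s = m") auto
qed

lemma has_vector_derivative_right_bound:
  assumes "(f has_vector_derivative d) (at t)" "e > 0"
  shows "\<forall>\<^sub>F s in at_right t. norm (f s - f t - (s - t) *\<^sub>R d) \<le> e * (s - t)"
proof -
  have "(f has_derivative (\<lambda>h. h *\<^sub>R d)) (at_right t)"
    using assms(1) has_derivative_at_withinI unfolding has_vector_derivative_def by blast
  then have "((\<lambda>y. (1 / norm (y - t)) *\<^sub>R (f y - (f t + (y - t) *\<^sub>R d))) \<longlongrightarrow> 0) (at_right t)"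
    by (simp add: has_derivative_within)
  then have "\<forall>\<^sub>F y in at_right t. norm ((1 / norm (y - t)) *\<^sub>R (f y - (f t + (y - t) *\<^sub>R d))) < e"
    using assms(2) by (simp add: tendsto_iff)
  moreover have "\<forall>\<^sub>F y in at_right t. y > t"
    by (simp add: eventually_at_right_less)
  ultimately show ?thesis
  proof eventually_elim
    case (elim y)
    then have "norm (f y - (f t + (y - t) *\<^sub>R d)) / (y - t) < e" by simp
    then show ?case using elim(2) by (simp add: divide_less_eq diff_diff_eq)
  qed
qed

text \<open>Below the barrier continuity suffices; at a contact point the speed of \<open>f\<close>
  is smaller than the slope of \<open>g\<close>. The norm of \<open>f\<close> is never
  differentiated, so \<open>f t\<close> may be zero.\<close>

lemma norm_le_barrier_right:
  assumes f: "(f has_vector_derivative f') (at t)" and g: "(g has_real_derivative d) (at t)"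
    and le: "norm (f t) \<le> g t" and eq: "norm (f t) = g t \<Longrightarrow> norm f' < d"
  shows "\<forall>\<^sub>F s in at_right t. norm (f s) \<le> g s"
proof (cases "norm (f t) = g t")
  case True
  define e where "e = (d - norm f') / 2"
  have e: "e > 0" using eq[OF True] by (simp add: e_def)
  have g': "(g has_vector_derivative d) (at t)"
    using g by (simp add: has_real_derivative_iff_has_vector_derivative)
  have "\<forall>\<^sub>F s in at_right t. s > t"
    by (simp add: eventually_at_right_less)
  with has_vector_derivative_right_bound[OF f e] has_vector_derivative_right_bound[OF g' e]
  show ?thesis
  proof eventually_elim
    case (elim s)
    have "norm (f s) \<le> norm (f s - f t - (s - t) *\<^sub>R f') + norm (f t) + norm ((s - t) *\<^sub>R f')"
      using norm_triangle_ineq[of "f s - f t - (s - t) *\<^sub>R f'" "f t + (s - t) *\<^sub>R f'"]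
        norm_triangle_ineq[of "f t" "(s - t) *\<^sub>R f'"] by simp
    also have "\<dots> \<le> e * (s - t) + g t + (s - t) * norm f'"
      using elim True by simp
    also have "\<dots> = g t + (s - t) * d - e * (s - t)"
      by (simp add: e_def field_simps)
    also have "\<dots> \<le> g s" using elim(2) by (simp add: abs_le_iff)
    finally show ?case .
  qed
next
  case False
  have "isCont (\<lambda>s. g s - norm (f s)) t"
    using f g by (intro continuous_intros)
      (auto dest: DERIV_isCont has_vector_derivative_continuous)
  then have "((\<lambda>s. g s - norm (f s)) \<longlongrightarrow> g t - norm (f t)) (at_right t)"
    by (simp add: isCont_def filterlim_at_split)
  then have "\<forall>\<^sub>F s in at_right t. 0 < g s - norm (f s)"
    using le False by (intro order_tendstoD(1)) auto
  then show ?thesis by eventually_elim simp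
qed

lemma isCont_nonneg_left:
  fixes F :: "real \<Rightarrow> real"
  assumes "isCont F t" "a < t" "\<And>s. a \<le> s \<Longrightarrow> s < t \<Longrightarrow> 0 \<le> F s"
  shows "0 \<le> F t"
proof (rule tendsto_lowerbound)
  show "(F \<longlongrightarrow> F t) (at_left t)"
    using assms(1) by (simp add: isCont_def filterlim_at_split)
  show "\<forall>\<^sub>F s in at_left t. 0 \<le> F s"
    unfolding eventually_at_left_field using assms(2,3) by (intro exI[of _ a]) auto
qed simp

text \<open>A Gronwall argument with barrier \<open>e * exp ((K + 1) * t)\<close>; the rate
  \<open>K + 1\<close> instead of \<open>K\<close> makes the comparison strict at contact. Then
  \<open>e\<close> tends to 0, and the endpoint 1 follows by continuity.\<close>

lemma ode_zero:
  fixes Y :: "real \<Rightarrow> 'a::real_normed_vector"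
  assumes der: "\<And>t. 0 \<le> t \<Longrightarrow> t \<le> 1 \<Longrightarrow> (Y has_vector_derivative Y' t) (at t)"
    and bnd: "\<And>t. 0 \<le> t \<Longrightarrow> t \<le> 1 \<Longrightarrow> norm (Y' t) \<le> K * norm (Y t)"
    and zero: "Y 0 = 0"
  shows "Y 1 = 0"
proof -
  have cont: "isCont Y t" if "0 \<le> t" "t \<le> 1" for t
    using has_vector_derivative_continuous[OF der[OF that]] .
  have bound: "norm (Y t) \<le> e * exp ((K + 1) * t)" if "0 \<le> t" "t < 1" "e > 0" for t e
  proof (rule interval_induction[where a = 0 and b = 1 and P = "\<lambda>t. norm (Y t) \<le> e * exp ((K + 1) * t)"])
    fix t :: real assume t: "0 < t" "t < 1"
      and IH: "\<And>s. 0 \<le> s \<Longrightarrow> s < t \<Longrightarrow> norm (Y s) \<le> e * exp ((K + 1) * s)"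
    have "isCont (\<lambda>t. e * exp ((K + 1) * t) - norm (Y t)) t"
      using cont t by (intro continuous_intros) auto
    from isCont_nonneg_left[OF this t(1)] show "norm (Y t) \<le> e * exp ((K + 1) * t)"
      using IH by auto
  next
    fix t :: real assume t: "0 \<le> t" "t < 1" and le: "norm (Y t) \<le> e * exp ((K + 1) * t)"
    have g: "((\<lambda>t. e * exp ((K + 1) * t)) has_real_derivative e * exp ((K + 1) * t) * (K + 1)) (at t)"
      by (auto intro!: derivative_eq_intros)
    show "\<forall>\<^sub>F s in at_right t. norm (Y s) \<le> e * exp ((K + 1) * s)"
    proof (rule norm_le_barrier_right[OF der g le])
      assume eq: "norm (Y t) = e * exp ((K + 1) * t)"
      have "norm (Y' t) \<le> K * norm (Y t)" using bnd t by simp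
      also have "\<dots> < norm (Y t) * (K + 1)"
        using eq \<open>e > 0\<close> by (simp add: algebra_simps)
      finally show "norm (Y' t) < e * exp ((K + 1) * t) * (K + 1)" using eq by simp
    qed (use t in auto)
  qed (use that zero in auto)
  have "norm (Y t) \<le> 0" if t: "0 \<le> t" "t < 1" for t
  proof (rule field_le_epsilon)
    fix e :: real assume "e > 0"
    then show "norm (Y t) \<le> 0 + e"
      using bound[OF t, of "e / exp ((K + 1) * t)"] by simp
  qed
  moreover have "isCont (\<lambda>t. - norm (Y t)) 1"
    using cont[of 1] by (intro continuous_intros) simp_all
  ultimately have "0 \<le> - norm (Y 1)"
    using isCont_nonneg_left[where F = "\<lambda>t. - norm (Y t)" and t = 1 and a = 0] by force
  then show ?thesis by simp
qed

lemma norm_has_real_derivative: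
  fixes U :: "real \<Rightarrow> 'a::real_inner"
  assumes "(U has_vector_derivative U') (at t)" "U t \<noteq> 0"
  shows "((\<lambda>s. norm (U s)) has_real_derivative inner U' (sgn (U t))) (at t)"
proof -
  have "(norm \<circ> U has_derivative (\<lambda>h. inner h (sgn (U t))) \<circ> (\<lambda>h. h *\<^sub>R U')) (at t)"
    using assms by (intro diff_chain_at)
      (auto simp: has_vector_derivative_def intro: has_derivative_norm)
  then show ?thesis
    by (simp add: has_field_derivative_def o_def mult.commute[of _ "inner _ _"])
qed

text \<open>The two bounds are propagated together: the first keeps \<open>U\<close> from decaying fast, the
  second makes \<open>norm U\<close> differentiable, so no Riccati quotient has to be formed.\<close>
lemma ray_comparison:
  fixes U :: "real \<Rightarrow> 'a::real_inner" and W :: "real \<Rightarrow> 'b::real_normed_vector"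
  assumes U: "\<And>t. 0 \<le> t \<Longrightarrow> t < 1 \<Longrightarrow> (U has_vector_derivative U' t) (at t)"
    and W: "\<And>t. 0 \<le> t \<Longrightarrow> t < 1 \<Longrightarrow> (W has_vector_derivative W' t) (at t)"
    and U': "\<And>t. 0 \<le> t \<Longrightarrow> t < 1 \<Longrightarrow> norm (U' t) \<le> c * norm (W t)"
    and W': "\<And>t. 0 \<le> t \<Longrightarrow> t < 1 \<Longrightarrow>
      norm (W' t) \<le> a / (1 - t\<^sup>2) * norm (W t) + b / (1 - t\<^sup>2)\<^sup>2 * norm (U t)"
    and init: "norm (U 0) = 1" "W 0 = 0"
    and const: "c > 0" "a \<ge> 0" "a + c * b < 1"
    and t: "0 \<le> t" "t < 1"
  shows "1 - t \<le> norm (U t) \<and> norm (W t) \<le> t / (c * (1 - t\<^sup>2)) * norm (U t)"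
proof -
  \<comment> \<open>\<open>h\<close> bounds the ratio of \<open>norm W\<close> to
    \<open>norm U\<close>; it is a strict supersolution of the corresponding Riccati equation, as
    \<open>key\<close> verifies.\<close>
  define h where "h s = s / (c * (1 - s\<^sup>2))" for s
  have d0: "0 < 1 - s\<^sup>2" if "0 \<le> s" "s < 1" for s :: real
    using that by (simp add: power_less_one_iff)
  have h': "(h has_real_derivative (1 + s\<^sup>2) / (c * (1 - s\<^sup>2)\<^sup>2)) (at s)" if "0 \<le> s" "s < 1" for s
    unfolding h_def[abs_def] using d0[OF that] const(1)
    by (auto intro!: derivative_eq_intros simp: divide_simps) (simp add: power2_eq_square algebra_simps)
  have contU: "isCont U s" and contW: "isCont W s" if "0 \<le> s" "s < 1" for s
    using has_vector_derivative_continuous U W that by blast+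
  have "1 - t \<le> norm (U t) \<and> norm (W t) \<le> h t * norm (U t)"
  proof (rule interval_induction[where a = 0 and b = 1
        and P = "\<lambda>t. 1 - t \<le> norm (U t) \<and> norm (W t) \<le> h t * norm (U t)"])
    fix t :: real assume t: "0 < t" "t < 1"
      and IH: "\<And>s. 0 \<le> s \<Longrightarrow> s < t \<Longrightarrow> 1 - s \<le> norm (U s) \<and> norm (W s) \<le> h s * norm (U s)"
    have ct: "isCont U t" "isCont W t" "isCont h t"
      using contU contW DERIV_isCont[OF h'] t by auto
    have "isCont (\<lambda>s. norm (U s) - (1 - s)) t" "isCont (\<lambda>s. h s * norm (U s) - norm (W s)) t"
      using ct by (auto intro!: continuous_intros)
    from this[THEN isCont_nonneg_left, OF t(1)]
    show "1 - t \<le> norm (U t) \<and> norm (W t) \<le> h t * norm (U t)"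
      using IH by auto
  next
    fix t :: real assume t: "0 \<le> t" "t < 1"
      and P: "1 - t \<le> norm (U t) \<and> norm (W t) \<le> h t * norm (U t)"
    have Upos: "norm (U t) > 0" using P t by linarith
    then have U0: "U t \<noteq> 0" by auto
    define d where "d = inner (U' t) (sgn (U t))"
    have nU: "((\<lambda>s. norm (U s)) has_real_derivative d) (at t)"
      unfolding d_def by (rule norm_has_real_derivative[OF U[OF t] U0])
    have "\<bar>d\<bar> \<le> norm (U' t) * norm (sgn (U t))"
      unfolding d_def by (rule Cauchy_Schwarz_ineq2)
    also have "\<dots> = norm (U' t)" using U0 by (simp add: norm_sgn)
    also have "\<dots> \<le> c * norm (W t)" by (rule U'[OF t])
    also have "\<dots> \<le> c * (h t * norm (U t))" using P const by (intro mult_left_mono) auto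
    finally have d: "\<bar>d\<bar> \<le> c * h t * norm (U t)" by simp
    \<comment> \<open>The lower bound takes the form of \<open>norm_le_barrier_right\<close> with
      the zero function under the barrier \<open>norm (U s) - (1 - s)\<close>.\<close>
    have "\<forall>\<^sub>F s in at_right t. norm (0 :: real) \<le> norm (U s) - (1 - s)"
    proof (rule norm_le_barrier_right[where f' = 0 and d = "d + 1"])
      show "((\<lambda>s. norm (U s) - (1 - s)) has_real_derivative d + 1) (at t)"
        using nU by (auto intro!: derivative_eq_intros)
      assume "norm (0 :: real) = norm (U t) - (1 - t)"
      then have "norm (U t) = 1 - t" by simp
      \<comment> \<open>At contact the value \<open>1 - t\<close> of \<open>norm (U t)\<close>
        cancels the singular factor of \<open>h\<close>, so \<open>norm U\<close> falls with speed
        below 1.\<close>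
      then have "\<bar>d\<bar> \<le> t / (1 - t\<^sup>2) * (1 - t)"
        using d const(1) by (simp add: h_def)
      also have "\<dots> = t / (1 + t)"
        using t d0[OF t] by (simp add: divide_simps) (simp add: power2_eq_square algebra_simps)
      also have "\<dots> < 1" using t by simp
      finally show "norm (0::real) < d + 1" by simp
    qed (use P in auto)
    moreover have "\<forall>\<^sub>F s in at_right t. norm (W s) \<le> h s * norm (U s)"
    proof (rule norm_le_barrier_right[OF W[OF t] DERIV_mult[OF h'[OF t] nU] conjunct2[OF P]])
      assume eq: "norm (W t) = h t * norm (U t)"
      have h0: "h t \<ge> 0" using t d0[OF t] const(1) by (simp add: h_def)
      \<comment> \<open>Over the common denominator \<open>c * (1 - t^2)^2\<close> the numerators
        are \<open>a * t + c * b + t^2\<close> and \<open>1 + t^2\<close>; here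
        \<open>a + c * b < 1\<close> enters.\<close>
      have key: "a / (1 - t\<^sup>2) * h t + b / (1 - t\<^sup>2)\<^sup>2 + c * h t * h t < (1 + t\<^sup>2) / (c * (1 - t\<^sup>2)\<^sup>2)"
      proof -
        have "a / (1 - t\<^sup>2) * h t + b / (1 - t\<^sup>2)\<^sup>2 + c * h t * h t
            = (a * t + c * b + t\<^sup>2) / (c * (1 - t\<^sup>2)\<^sup>2)"
          using const(1) d0[OF t] by (simp add: h_def divide_simps) (simp add: power2_eq_square algebra_simps)
        moreover have "a * t + c * b + t\<^sup>2 < 1 + t\<^sup>2"
          using const mult_left_mono[of t 1 a] t by simp
        ultimately show ?thesis
          using const(1) d0[OF t] by (simp add: divide_strict_right_mono)
      qed
      have "norm (W' t) \<le> (a / (1 - t\<^sup>2) * h t + b / (1 - t\<^sup>2)\<^sup>2) * norm (U t)"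
        using W'[OF t] eq by (simp add: algebra_simps)
      also have "\<dots> < ((1 + t\<^sup>2) / (c * (1 - t\<^sup>2)\<^sup>2) - c * h t * h t) * norm (U t)"
        using key Upos by (intro mult_strict_right_mono) auto
      also have "\<dots> \<le> (1 + t\<^sup>2) / (c * (1 - t\<^sup>2)\<^sup>2) * norm (U t) + d * h t"
      proof -
        have "- d * h t \<le> c * h t * norm (U t) * h t"
          using d h0 by (intro mult_right_mono) auto
        then show ?thesis by (simp add: algebra_simps)
      qed
      finally show "norm (W' t) < (1 + t\<^sup>2) / (c * (1 - t\<^sup>2)\<^sup>2) * norm (U t) + d * h t" .
    qed
    ultimately show "\<forall>\<^sub>F s in at_right t. 1 - s \<le> norm (U s) \<and> norm (W s) \<le> h s * norm (U s)"
      by eventually_elim simp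
  qed (use t init in \<open>auto simp: h_def\<close>)
  then show ?thesis by (simp add: h_def)
qed

subsection \<open>Completely integrable systems\<close>

lemma cpartial_cong:
  assumes "open S" "z \<in> S" "\<And>w. w \<in> S \<Longrightarrow> f w = g w"
  shows "cpartial i f z = cpartial i g z"
  unfolding cpartial_def
proof (rule deriv_cong_ev)
  have "open {t. z + t *s axis i 1 \<in> S}" "0 \<in> {t. z + t *s axis i 1 \<in> S}"
    using open_line_preimage[OF assms(1)] assms(2) by auto
  then show "\<forall>\<^sub>F t in nhds 0. f (z + t *s axis i 1) = g (z + t *s axis i 1)"
    unfolding eventually_nhds using assms(3) by blast
qed simp

lemma slice_holomorphic_lincomb:
  fixes U :: "'m \<Rightarrow> complex ^ 'n::finite \<Rightarrow> complex"
  assumes U: "\<And>m. m \<in> M \<Longrightarrow> slice_holomorphic (U m) S"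
  shows "slice_holomorphic (\<lambda>z. \<Sum>m\<in>M. c m * U m z) S"
    and "z \<in> S \<Longrightarrow> cpartial i (\<lambda>z. \<Sum>m\<in>M. c m * U m z) z = (\<Sum>m\<in>M. c m * cpartial i (U m) z)"
proof -
  have der: "((\<lambda>t. \<Sum>m\<in>M. c m * U m (z + t *s v)) has_field_derivative
      (\<Sum>m\<in>M. c m * (\<Sum>j\<in>UNIV. v $ j * cpartial j (U m) z))) (at 0)" if "z \<in> S" for z v
    using U that unfolding slice_holomorphic_def by (intro DERIV_sum DERIV_cmult) blast
  have cp: "cpartial i (\<lambda>z. \<Sum>m\<in>M. c m * U m z) z = (\<Sum>m\<in>M. c m * cpartial i (U m) z)"
    if "z \<in> S" for z i
    using cpartial_eqI[OF der[OF that, of "axis i 1"]] by simp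
  then show "z \<in> S \<Longrightarrow> cpartial i (\<lambda>z. \<Sum>m\<in>M. c m * U m z) z = (\<Sum>m\<in>M. c m * cpartial i (U m) z)" .
  show "slice_holomorphic (\<lambda>z. \<Sum>m\<in>M. c m * U m z) S"
    unfolding slice_holomorphic_def
  proof (intro conjI ballI allI)
    show "continuous_on S (\<lambda>z. \<Sum>m\<in>M. c m * U m z)"
      using U unfolding slice_holomorphic_def by (intro continuous_intros) auto
    fix z v assume z: "z \<in> S"
    have "(\<Sum>m\<in>M. c m * (\<Sum>j\<in>UNIV. v $ j * cpartial j (U m) z))
        = (\<Sum>m\<in>M. \<Sum>j\<in>UNIV. v $ j * (c m * cpartial j (U m) z))"
      by (simp add: sum_distrib_left mult.left_commute)
    also have "\<dots> = (\<Sum>j\<in>UNIV. \<Sum>m\<in>M. v $ j * (c m * cpartial j (U m) z))"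
      by (rule sum.swap)
    also have "\<dots> = (\<Sum>j\<in>UNIV. v $ j * cpartial j (\<lambda>z. \<Sum>m\<in>M. c m * U m z) z)"
      by (simp add: cp[OF z] sum_distrib_left)
    finally show "((\<lambda>t. \<Sum>m\<in>M. c m * U m (z + t *s v)) has_field_derivative
        (\<Sum>j\<in>UNIV. v $ j * cpartial j (\<lambda>z. \<Sum>m\<in>M. c m * U m z) z)) (at 0)"
      using der[OF z, of v] by simp
  qed
qed

lemma convex_polydisc: "convex (polydisc :: (complex ^ 'n::finite) set)"
proof (rule convexI)
  fix x y :: "complex ^ 'n" and a b :: real
  assume xy: "x \<in> polydisc" "y \<in> polydisc" and ab: "0 \<le> a" "0 \<le> b" "a + b = 1"
  have "norm (a *\<^sub>R x $ i + b *\<^sub>R y $ i) < 1" for i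
    using convexD[OF convex_ball[of "0::complex" 1], of "x $ i" "y $ i" a b] xy ab
    by (simp add: polydisc_def)
  then show "a *\<^sub>R x + b *\<^sub>R y \<in> polydisc" by (simp add: polydisc_def)
qed

section \<open>First-order jets and uniqueness of solutions\<close>

lemma sum_option_UNIV:
  "(\<Sum>x\<in>UNIV. f x) = f None + (\<Sum>i\<in>UNIV. f (Some i))" for f :: "'n::finite option \<Rightarrow> 'a::comm_monoid_add"
  by (simp add: UNIV_option_conv sum.reindex)

text \<open>\<open>None\<close> carries the value and \<open>Some k\<close> the partial derivatives,
  so a jet has \<open>n + 1\<close> entries, as many as there are independent solutions.\<close>

definition jet :: "(complex ^ 'n::finite \<Rightarrow> complex) \<Rightarrow> complex ^ 'n \<Rightarrow> complex ^ ('n option)" where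
  "jet u z = (\<chi> x. case x of None \<Rightarrow> u z | Some k \<Rightarrow> cpartial k u z)"

lemma jet_simps [simp]: "jet u z $ None = u z" "jet u z $ Some k = cpartial k u z"
  by (simp_all add: jet_def)

lemma is_solution_imp_slice_holomorphic:
  "is_solution P P0 u \<Longrightarrow> slice_holomorphic u polydisc"
  by (simp add: is_solution_def holomorphic_cn_imp_slice_holomorphic)

locale holomorphic_system =
  fixes P :: "'n::finite \<Rightarrow> 'n \<Rightarrow> 'n \<Rightarrow> complex ^ 'n \<Rightarrow> complex"
    and P0 :: "'n \<Rightarrow> 'n \<Rightarrow> complex ^ 'n \<Rightarrow> complex"
  assumes hol_P: "holomorphic_cn (P i j k) polydisc"
    and hol_P0: "holomorphic_cn (P0 i j) polydisc"
begin

lemmas slice_P = holomorphic_cn_imp_slice_holomorphic[OF hol_P]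
  and slice_P0 = holomorphic_cn_imp_slice_holomorphic[OF hol_P0]

definition solves :: "(complex ^ 'n \<Rightarrow> complex) \<Rightarrow> bool" where
  "solves u \<longleftrightarrow> slice_holomorphic u polydisc \<and>
    (\<forall>z\<in>polydisc. \<forall>i j. cpartial i (cpartial j u) z
       = (\<Sum>k\<in>UNIV. P i j k z * cpartial k u z) + P0 i j z * u z)"

lemma is_solution_imp_solves: "is_solution P P0 u \<Longrightarrow> solves u"
  by (simp add: solves_def is_solution_imp_slice_holomorphic) (simp add: is_solution_def)

lemma solves_lincomb:
  assumes U: "\<And>m. m \<in> M \<Longrightarrow> solves (U m)"
  shows "solves (\<lambda>z. \<Sum>m\<in>M. c m * U m z)"
proof -
  have sl: "slice_holomorphic (U m) polydisc" if "m \<in> M" for m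
    using U[OF that] by (simp add: solves_def)
  have sl': "slice_holomorphic (cpartial j (U m)) polydisc" if "m \<in> M" for m j
    by (rule slice_holomorphic_cpartial[OF open_polydisc sl[OF that]])
  let ?u = "\<lambda>z. \<Sum>m\<in>M. c m * U m z"
  have "cpartial i (cpartial j ?u) z = (\<Sum>k\<in>UNIV. P i j k z * cpartial k ?u z) + P0 i j z * ?u z"
    if z: "z \<in> polydisc" for z i j
  proof -
    have "cpartial i (cpartial j ?u) z = cpartial i (\<lambda>z. \<Sum>m\<in>M. c m * cpartial j (U m) z) z"
      by (rule cpartial_cong[OF open_polydisc z]) (rule slice_holomorphic_lincomb(2)[OF sl])
    also have "\<dots> = (\<Sum>m\<in>M. c m * cpartial i (cpartial j (U m)) z)"
      by (rule slice_holomorphic_lincomb(2)[OF sl' z])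
    also have "\<dots> = (\<Sum>m\<in>M. c m * ((\<Sum>k\<in>UNIV. P i j k z * cpartial k (U m) z) + P0 i j z * U m z))"
      using U z by (intro sum.cong) (auto simp: solves_def)
    also have "\<dots> = (\<Sum>m\<in>M. \<Sum>k\<in>UNIV. P i j k z * (c m * cpartial k (U m) z)) + P0 i j z * ?u z"
      by (simp add: distrib_left sum.distrib sum_distrib_left mult.left_commute)
    also have "(\<Sum>m\<in>M. \<Sum>k\<in>UNIV. P i j k z * (c m * cpartial k (U m) z))
        = (\<Sum>k\<in>UNIV. \<Sum>m\<in>M. P i j k z * (c m * cpartial k (U m) z))"
      by (rule sum.swap)
    also have "\<dots> = (\<Sum>k\<in>UNIV. P i j k z * cpartial k ?u z)"
    proof -
      have "cpartial k ?u z = (\<Sum>m\<in>M. c m * cpartial k (U m) z)" for k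
        by (rule slice_holomorphic_lincomb(2)[OF sl z])
      then show ?thesis by (simp add: sum_distrib_left)
    qed
    finally show ?thesis .
  qed
  then show ?thesis
    using slice_holomorphic_lincomb(1)[OF sl] by (simp add: solves_def)
qed

text \<open>The system expresses second derivatives through the jet, so along a real segment the jet
  obeys a closed linear ODE of first order.\<close>

lemma solves_line_derivative:
  assumes u: "solves u" and x: "z + of_real t *s v \<in> polydisc"
  shows "((\<lambda>t. u (z + of_real t *s v)) has_vector_derivative
      (\<Sum>j\<in>UNIV. v $ j * cpartial j u (z + of_real t *s v))) (at t)"
    and "((\<lambda>t. cpartial i u (z + of_real t *s v)) has_vector_derivative
      (\<Sum>j\<in>UNIV. v $ j * ((\<Sum>k\<in>UNIV. P j i k (z + of_real t *s v) * cpartial k u (z + of_real t *s v))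
        + P0 j i (z + of_real t *s v) * u (z + of_real t *s v)))) (at t)"
proof -
  have sl: "slice_holomorphic u polydisc" using u by (simp add: solves_def)
  show "((\<lambda>t. u (z + of_real t *s v)) has_vector_derivative
      (\<Sum>j\<in>UNIV. v $ j * cpartial j u (z + of_real t *s v))) (at t)"
    by (rule has_vector_derivative_real_field[OF slice_holomorphic_line[OF sl x]])
  have eq: "cpartial j (cpartial i u) (z + of_real t *s v)
      = (\<Sum>k\<in>UNIV. P j i k (z + of_real t *s v) * cpartial k u (z + of_real t *s v))
        + P0 j i (z + of_real t *s v) * u (z + of_real t *s v)" for j
    using u x by (simp add: solves_def)
  show "((\<lambda>t. cpartial i u (z + of_real t *s v)) has_vector_derivative
      (\<Sum>j\<in>UNIV. v $ j * ((\<Sum>k\<in>UNIV. P j i k (z + of_real t *s v) * cpartial k u (z + of_real t *s v))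
        + P0 j i (z + of_real t *s v) * u (z + of_real t *s v)))) (at t)"
    unfolding eq[symmetric]
    by (rule has_vector_derivative_real_field
        [OF slice_holomorphic_line[OF slice_holomorphic_cpartial[OF open_polydisc sl] x]])
qed

text \<open>The segment from \<open>z0\<close> to \<open>z\<close> lies in the convex polydisc.
  Along it the jet solves a linear ODE with bounded coefficients and zero initial value, so
  \<open>ode_zero\<close> applies.\<close>

lemma solves_eq_zero:
  assumes u: "solves u" and z0: "z0 \<in> polydisc" and zero: "jet u z0 = 0" and z: "z \<in> polydisc"
  shows "u z = 0"
proof -
  define v where "v = z - z0"
  define x where "x t = z0 + of_real t *s v" for t :: real
  have x: "x t \<in> polydisc" if "0 \<le> t" "t \<le> 1" for t
  proof -
    have "x t = (1 - t) *\<^sub>R z0 + t *\<^sub>R z"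
      by (simp add: x_def v_def vec_eq_iff) (simp add: scaleR_conv_of_real algebra_simps)
    then show ?thesis
      using convexD[OF convex_polydisc z0 z, of "1 - t" t] that by simp
  qed
  define Y' where "Y' t = (\<chi> w. case w of None \<Rightarrow> (\<Sum>j\<in>UNIV. v $ j * cpartial j u (x t))
    | Some i \<Rightarrow> (\<Sum>j\<in>UNIV. v $ j * ((\<Sum>k\<in>UNIV. P j i k (x t) * cpartial k u (x t)) + P0 j i (x t) * u (x t))))" for t
  \<comment> \<open>A crude bound for the coefficient matrix, the sum of the moduli of all
    contributions; it is bounded by continuity on a compact interval.\<close>
  define K where "K t = (\<Sum>j\<in>UNIV. norm (v $ j)) +
    (\<Sum>i\<in>UNIV. \<Sum>j\<in>UNIV. norm (v $ j) * ((\<Sum>k\<in>UNIV. norm (P j i k (x t))) + norm (P0 j i (x t))))" for t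
  have contx: "continuous_on {0..1} x"
    unfolding x_def
    by (rule continuous_on_compose2[OF continuous_on_smult_line[of UNIV]]) (auto intro!: continuous_intros)
  have sub: "x ` {0..1} \<subseteq> polydisc" using x by auto
  have "continuous_on polydisc (P i j k)" "continuous_on polydisc (P0 i j)" for i j k
    using slice_P slice_P0 by (auto simp: slice_holomorphic_def)
  then have "continuous_on {0..1} (\<lambda>t. P i j k (x t))" "continuous_on {0..1} (\<lambda>t. P0 i j (x t))" for i j k
    using continuous_on_compose2[OF _ contx sub] by blast+
  then have "continuous_on {0..1} K"
    unfolding K_def by (intro continuous_intros)
  from continuous_attains_sup[OF compact_Icc _ this]
  obtain s where "\<forall>t\<in>{0..1}. K t \<le> K s" by auto
  then obtain B where B: "\<And>t. t \<in> {0..1} \<Longrightarrow> K t \<le> B" by blast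
  have "jet u (x 1) = 0"
  proof (rule ode_zero[where Y = "\<lambda>t. jet u (x t)" and Y' = Y' and K = B])
    fix t :: real assume t: "0 \<le> t" "t \<le> 1"
    have xt: "z0 + of_real t *s v \<in> polydisc" using x[OF t] by (simp add: x_def)
    show "((\<lambda>t. jet u (x t)) has_vector_derivative Y' t) (at t)"
      unfolding jet_def Y'_def
    proof (rule has_vector_derivative_vec_lambda)
      fix w :: "'n option"
      show "((\<lambda>t. case w of None \<Rightarrow> u (x t) | Some k \<Rightarrow> cpartial k u (x t)) has_vector_derivative
         (case w of None \<Rightarrow> (\<Sum>j\<in>UNIV. v $ j * cpartial j u (x t))
    | Some i \<Rightarrow> (\<Sum>j\<in>UNIV. v $ j * ((\<Sum>k\<in>UNIV. P j i k (x t) * cpartial k u (x t)) + P0 j i (x t) * u (x t))))) (at t)"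
        using solves_line_derivative[OF u xt] by (cases w) (simp_all add: x_def)
    qed
    let ?Y = "norm (jet u (x t))"
    have c: "norm (cpartial k u (x t)) \<le> ?Y" "norm (u (x t)) \<le> ?Y" for k
      using Finite_Cartesian_Product.norm_nth_le[of "jet u (x t)" "Some k"]
        Finite_Cartesian_Product.norm_nth_le[of "jet u (x t)" None] by simp_all
    have "norm (Y' t) \<le> (\<Sum>w\<in>UNIV. norm (Y' t $ w))"
      unfolding norm_vec_def by (rule L2_set_le_sum) simp
    also have "\<dots> = norm (\<Sum>j\<in>UNIV. v $ j * cpartial j u (x t)) +
       (\<Sum>i\<in>UNIV. norm (\<Sum>j\<in>UNIV. v $ j * ((\<Sum>k\<in>UNIV. P j i k (x t) * cpartial k u (x t)) + P0 j i (x t) * u (x t))))"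
      by (simp add: sum_option_UNIV Y'_def)
    also have "\<dots> \<le> (\<Sum>j\<in>UNIV. norm (v $ j) * ?Y) +
       (\<Sum>i\<in>UNIV. \<Sum>j\<in>UNIV. norm (v $ j) * ((\<Sum>k\<in>UNIV. norm (P j i k (x t)) * ?Y) + norm (P0 j i (x t)) * ?Y))"
      by (intro add_mono sum_mono order_trans[OF norm_sum] order_trans[OF norm_triangle_ineq]
          mult_mono order_trans[OF eq_refl[OF norm_mult]] sum_norm_le c mult_left_mono) (auto intro: c sum_nonneg)
    also have "\<dots> = K t * ?Y"
      by (simp add: K_def sum_distrib_right sum_distrib_left algebra_simps sum.distrib)
    also have "\<dots> \<le> B * ?Y" using B t by (intro mult_right_mono) auto
    finally show "norm (Y' t) \<le> B * ?Y" .
  qed (simp add: x_def zero)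
  then have "jet u z $ None = 0" by (simp add: x_def v_def)
  then show ?thesis by simp
qed

end

locale integrable_system = holomorphic_system P P0
  for P :: "'n::finite \<Rightarrow> 'n \<Rightarrow> 'n \<Rightarrow> complex ^ 'n \<Rightarrow> complex" and P0 +
  assumes integrable: "completely_integrable P P0"
begin

text \<open>By uniqueness the jets at \<open>z\<close> of the \<open>n + 1\<close> independent solutions form a basis, so a
  linear relation satisfied by all jets is trivial.\<close>
lemma jet_functional_eq_zero:
  fixes l :: "'n option \<Rightarrow> complex"
  assumes z: "z \<in> polydisc"
    and l: "\<And>u. solves u \<Longrightarrow> (\<Sum>w\<in>UNIV. l w * jet u z $ w) = 0"
  shows "l w = 0"
proof -
  obtain U :: "nat \<Rightarrow> complex ^ 'n \<Rightarrow> complex" where U: "\<And>m. m \<le> CARD('n) \<Longrightarrow> is_solution P P0 (U m)"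
    and ind: "\<And>c m. \<forall>z\<in>polydisc. (\<Sum>m\<le>CARD('n). c m * U m z) = 0 \<Longrightarrow> m \<le> CARD('n) \<Longrightarrow> c m = 0"
    using integrable unfolding completely_integrable_def by blast
  have "card (UNIV :: 'n option set) = card {..CARD('n)}" by (simp add: card_UNIV_option)
  \<comment> \<open>The solutions are relabelled by the index type of jets, which makes the matrix
    \<open>A\<close> of their jets square.\<close>
  then obtain b where b: "bij_betw b (UNIV :: 'n option set) {..CARD('n)}"
    using finite_same_card_bij[of "UNIV :: 'n option set" "{..CARD('n)}"] by auto
  have bc: "b c \<le> CARD('n)" for c
    using bij_betwE[OF b] by auto
  have solU: "solves (U (b c))" for c
    by (rule is_solution_imp_solves[OF U[OF bc]])
  define A :: "complex ^ 'n option ^ 'n option" where "A = (\<chi> r c. jet (U (b c)) z $ r)"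
  \<comment> \<open>A kernel vector gives a solution with zero jet at \<open>z\<close>. Uniqueness
    makes it vanish identically, and independence then makes the vector zero.\<close>
  have "x = 0" if "A *v x = 0" for x
  proof -
    define u where "u w = (\<Sum>c\<in>UNIV. x $ c * U (b c) w)" for w
    have sol: "solves u" unfolding u_def by (rule solves_lincomb) (rule solU)
    have "jet u z $ r = (A *v x) $ r" for r
    proof (cases r)
      case (Some k)
      have "cpartial k u z = (\<Sum>c\<in>UNIV. x $ c * cpartial k (U (b c)) z)"
        unfolding u_def by (rule slice_holomorphic_lincomb(2)[OF _ z]) (use solU in \<open>simp add: solves_def\<close>)
      then show ?thesis
        by (simp add: Some A_def matrix_vector_mult_def mult.commute)
    qed (simp add: A_def matrix_vector_mult_def u_def mult.commute)
    then have "jet u z = 0" using that by (simp add: vec_eq_iff)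
    then have "u w = 0" if "w \<in> polydisc" for w
      using solves_eq_zero[OF sol z _ that] by simp
    moreover have "u w = (\<Sum>m\<le>CARD('n). x $ (inv_into UNIV b m) * U m w)" for w
    proof -
      have "(\<Sum>m\<in>b ` UNIV. x $ (inv_into UNIV b m) * U m w) = u w"
        unfolding u_def using b by (subst sum.reindex) (auto simp: bij_betw_def)
      then show ?thesis using b by (simp add: bij_betw_def)
    qed
    ultimately have "x $ (inv_into UNIV b m) = 0" if "m \<le> CARD('n)" for m
      using ind[of "\<lambda>m. x $ (inv_into UNIV b m)" m] that by simp
    moreover have "b c \<le> CARD('n)" "inv_into UNIV b (b c) = c" for c
      using b by (auto simp: bij_betw_def)
    ultimately have "x $ c = 0" for c by metis
    then show ?thesis by (simp add: vec_eq_iff)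
  qed
  then have "surj ((*v) A)"
    using matrix_left_invertible_ker[of A] matrix_right_invertible_surjective[of A]
      matrix_left_right_inverse by metis
  \<comment> \<open>The unit jet at \<open>w\<close> is a combination of jets of solutions, on each
    of which \<open>l\<close> vanishes.\<close>
  then obtain x where x: "A *v x = axis w 1" by (metis surjD)
  have "l w = (\<Sum>r\<in>UNIV. l r * (A *v x) $ r)"
    unfolding x using sum_axis_mult[of w l] by (simp add: mult.commute)
  also have "\<dots> = (\<Sum>r\<in>UNIV. \<Sum>c\<in>UNIV. x $ c * (l r * jet (U (b c)) z $ r))"
    by (simp add: matrix_vector_mult_def A_def sum_distrib_left mult_ac)
  also have "\<dots> = (\<Sum>c\<in>UNIV. x $ c * (\<Sum>r\<in>UNIV. l r * jet (U (b c)) z $ r))"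
    by (subst sum.swap) (simp add: sum_distrib_left)
  also have "\<dots> = 0" using l[OF solU] by simp
  finally show ?thesis .
qed

text \<open>The difference of the two sides is a functional that vanishes on all jets. Identities
  valid for every solution can thus be compared coefficient by coefficient.\<close>

lemma jet_functional_unique:
  assumes z: "z \<in> polydisc"
    and eq: "\<And>u. solves u \<Longrightarrow> (\<Sum>k\<in>UNIV. l k * cpartial k u z) + a * u z
      = (\<Sum>k\<in>UNIV. l' k * cpartial k u z) + a' * u z"
  shows "l k = l' k" and "a = a'"
proof -
  let ?l = "\<lambda>w. case w of None \<Rightarrow> a - a' | Some k \<Rightarrow> l k - l' k"
  have "?l w = 0" for w
  proof (rule jet_functional_eq_zero[OF z])
    fix u assume "solves u"
    from eq[OF this] show "(\<Sum>w\<in>UNIV. ?l w * jet u z $ w) = 0"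
      by (simp add: sum_option_UNIV left_diff_distrib sum_subtractf algebra_simps)
  qed
  from this[of "Some k"] this[of None] show "l k = l' k" "a = a'" by simp_all
qed

section \<open>Symmetry and integrability conditions for the coefficients\<close>

text \<open>Mixed second derivatives of every solution agree, so the two equations for them have
  equal coefficients.\<close>

lemma coefficients_symmetric:
  assumes z: "z \<in> polydisc"
  shows "P i j k z = P j i k z" and "P0 i j z = P0 j i z"
proof -
  have "(\<Sum>k\<in>UNIV. P i j k z * cpartial k u z) + P0 i j z * u z
      = (\<Sum>k\<in>UNIV. P j i k z * cpartial k u z) + P0 j i z * u z" if u: "solves u" for u
    using u z cpartial_commute[OF open_polydisc _ z, of u i j] by (simp add: solves_def)
  from jet_functional_unique[OF z this]
  show "P i j k z = P j i k z" "P0 i j z = P0 j i z" by auto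
qed

text \<open>Comparison of the coefficients of \<open>\<partial>\<^sub>m u\<close> in \<open>\<partial>\<^sub>l \<partial>\<^sub>j \<partial>\<^sub>i u = \<partial>\<^sub>j \<partial>\<^sub>l \<partial>\<^sub>i u\<close>.\<close>
lemma integrability_condition:
  assumes z: "z \<in> polydisc"
  defines "C \<equiv> \<lambda>j l i m. cpartial l (P j i m) z + (\<Sum>k\<in>UNIV. P j i k z * P l k m z)
    + (if m = l then P0 j i z else 0)"
  shows "C j l i m = C l j i m"
proof -
  define c where "c j l = (\<Sum>k\<in>UNIV. P j i k z * P0 l k z) + cpartial l (P0 j i) z" for j l
  \<comment> \<open>The system is differentiated and then used again to eliminate second
    derivatives. \<open>C\<close> and \<open>c\<close> collect the coefficients of
    \<open>cpartial m u\<close> and of \<open>u\<close>; the \<open>if\<close> in \<open>C\<close>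
    stems from the product of \<open>P0 j i\<close> and \<open>cpartial l u\<close>.\<close>
  have third: "cpartial l (cpartial j (cpartial i u)) z
      = (\<Sum>m\<in>UNIV. C j l i m * cpartial m u z) + c j l * u z" if u: "solves u" for u j l
  proof -
    have sl: "slice_holomorphic u polydisc" using u by (simp add: solves_def)
    have eq: "cpartial i (cpartial j u) w = (\<Sum>k\<in>UNIV. P i j k w * cpartial k u w) + P0 i j w * u w"
      if "w \<in> polydisc" for w i j
      using u that by (simp add: solves_def)
    note d = slice_holomorphic_axis[OF _ z]
    have "cpartial l (cpartial j (cpartial i u)) z
        = cpartial l (\<lambda>w. (\<Sum>k\<in>UNIV. P j i k w * cpartial k u w) + P0 j i w * u w) z"
      by (rule cpartial_cong[OF open_polydisc z eq])
    also have "\<dots> = (\<Sum>k\<in>UNIV. cpartial l (P j i k) z * cpartial k u z + cpartial l (cpartial k u) z * P j i k z)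
        + (cpartial l (P0 j i) z * u z + cpartial l u z * P0 j i z)"
      by (rule cpartial_eqI, intro DERIV_add DERIV_sum)
        (use DERIV_mult[OF d[OF slice_P] d[OF slice_holomorphic_cpartial[OF open_polydisc sl]]]
          DERIV_mult[OF d[OF slice_P0] d[OF sl]] in simp_all)
    also have "\<dots> = (\<Sum>k\<in>UNIV. cpartial l (P j i k) z * cpartial k u z)
        + (\<Sum>k\<in>UNIV. \<Sum>m\<in>UNIV. P j i k z * P l k m z * cpartial m u z)
        + P0 j i z * cpartial l u z + c j l * u z"
      by (simp add: eq[OF z] c_def sum.distrib algebra_simps sum_distrib_left sum_distrib_right)
    also have "(\<Sum>k\<in>UNIV. \<Sum>m\<in>UNIV. P j i k z * P l k m z * cpartial m u z)
        = (\<Sum>m\<in>UNIV. (\<Sum>k\<in>UNIV. P j i k z * P l k m z) * cpartial m u z)"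
      by (subst sum.swap) (simp add: sum_distrib_right)
    also have "P0 j i z * cpartial l u z = (\<Sum>m\<in>UNIV. (if m = l then P0 j i z else 0) * cpartial m u z)"
      by (simp add: if_distrib[where f="\<lambda>x. x * _"] cong: if_cong)
    finally show ?thesis
      by (simp add: C_def distrib_right sum.distrib)
  qed
  have "(\<Sum>m\<in>UNIV. C j l i m * cpartial m u z) + c j l * u z
      = (\<Sum>m\<in>UNIV. C l j i m * cpartial m u z) + c l j * u z" if u: "solves u" for u
  proof -
    have "slice_holomorphic (cpartial i u) polydisc"
      using u by (simp add: solves_def slice_holomorphic_cpartial[OF open_polydisc])
    from cpartial_commute[OF open_polydisc this z] show ?thesis
      unfolding third[OF u, symmetric] .
  qed
  from jet_functional_unique(1)[OF z this] show ?thesis .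
qed

text \<open>On the diagonal \<open>x = y\<close> this is \<open>quad_op P z\<close>.\<close>

definition bil :: "complex ^ 'n \<Rightarrow> complex ^ 'n \<Rightarrow> complex ^ 'n \<Rightarrow> complex ^ 'n" where
  "bil z x y = (\<chi> k. \<Sum>i\<in>UNIV. \<Sum>j\<in>UNIV. P i j k z * x $ i * y $ j)"

text \<open>The base point comes last: for fixed vectors and a fixed covector \<open>\<mu>\<close>
  this is a scalar holomorphic function, open to the maximum principle and the derivative
  estimates.\<close>

definition tri :: "complex ^ 'n \<Rightarrow> complex ^ 'n \<Rightarrow> complex ^ 'n \<Rightarrow> complex ^ 'n \<Rightarrow> complex" where
  "tri x y \<mu> z = (\<Sum>i\<in>UNIV. \<Sum>j\<in>UNIV. \<Sum>k\<in>UNIV. (x $ i * y $ j * \<mu> $ k) * P i j k z)"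

definition bil0 :: "complex ^ 'n \<Rightarrow> complex ^ 'n \<Rightarrow> complex ^ 'n \<Rightarrow> complex" where
  "bil0 z x y = (\<Sum>i\<in>UNIV. \<Sum>j\<in>UNIV. P0 i j z * x $ i * y $ j)"

lemma tri_eq_bil: "tri x y \<mu> z = (\<Sum>k\<in>UNIV. bil z x y $ k * \<mu> $ k)"
proof -
  have "(\<Sum>k\<in>UNIV. bil z x y $ k * \<mu> $ k) = (\<Sum>k\<in>UNIV. \<Sum>i\<in>UNIV. \<Sum>j\<in>UNIV. (x $ i * y $ j * \<mu> $ k) * P i j k z)"
    by (simp add: bil_def sum_distrib_right sum_distrib_left mult_ac)
  also have "\<dots> = (\<Sum>i\<in>UNIV. \<Sum>k\<in>UNIV. \<Sum>j\<in>UNIV. (x $ i * y $ j * \<mu> $ k) * P i j k z)"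
    by (rule sum.swap)
  also have "\<dots> = tri x y \<mu> z"
    unfolding tri_def by (intro sum.cong refl sum.swap)
  finally show ?thesis by simp
qed

text \<open>Full complex differentiability is established because
  \<open>polydisc_deriv_bound\<close> composes with curved discs.\<close>

lemma holomorphic_cn_tri: "holomorphic_cn (tri x y \<mu>) polydisc"
  unfolding holomorphic_cn_def
proof
  fix z :: "complex ^ 'n" assume z: "z \<in> polydisc"
  have "\<forall>i j k. \<exists>D. (P i j k has_derivative D) (at z) \<and> (\<forall>c v. D (c *s v) = c * D v)"
    using hol_P z unfolding holomorphic_cn_def by blast
  then obtain D where D: "\<And>i j k. (P i j k has_derivative D i j k) (at z)"
    and lin: "\<And>i j k c v. D i j k (c *s v) = c * D i j k v"
    by metis
  let ?D = "\<lambda>v. \<Sum>i\<in>UNIV. \<Sum>j\<in>UNIV. \<Sum>k\<in>UNIV. (x $ i * y $ j * \<mu> $ k) * D i j k v"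
  have "(tri x y \<mu> has_derivative ?D) (at z)"
    unfolding tri_def[abs_def] by (intro has_derivative_sum has_derivative_mult_right D)
  moreover have "?D (c *s v) = c * ?D v" for c v
    by (simp add: lin sum_distrib_left mult_ac)
  ultimately show "\<exists>D. (tri x y \<mu> has_derivative D) (at z) \<and> (\<forall>c v. D (c *s v) = c * D v)"
    by blast
qed

lemmas slice_tri = holomorphic_cn_imp_slice_holomorphic[OF holomorphic_cn_tri]

lemma cpartial_tri:
  assumes "z \<in> polydisc"
  shows "cpartial l (tri x y \<mu>) z
    = (\<Sum>i\<in>UNIV. \<Sum>j\<in>UNIV. \<Sum>k\<in>UNIV. (x $ i * y $ j * \<mu> $ k) * cpartial l (P i j k) z)"
  unfolding tri_def[abs_def]
  by (rule cpartial_eqI, intro DERIV_sum DERIV_cmult slice_holomorphic_axis[OF slice_P assms])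

text \<open>\<open>integrability_condition\<close> is multiplied by
  \<open>x $ j * e $ l * v $ i * \<mu> $ m\<close> and summed over all indices.\<close>

lemma contracted_integrability:
  assumes z: "z \<in> polydisc"
  shows "(\<Sum>l\<in>UNIV. e $ l * cpartial l (tri x v \<mu>) z) + tri e (bil z x v) \<mu> z
      + bil0 z x v * (\<Sum>m\<in>UNIV. e $ m * \<mu> $ m)
    = (\<Sum>l\<in>UNIV. x $ l * cpartial l (tri e v \<mu>) z) + tri x (bil z e v) \<mu> z
      + bil0 z e v * (\<Sum>m\<in>UNIV. x $ m * \<mu> $ m)"
proof -
  define C where "C j l i m = cpartial l (P j i m) z + (\<Sum>k\<in>UNIV. P j i k z * P l k m z)
    + (if m = l then P0 j i z else 0)" for j l i m
  define F where "F x e j l = (\<Sum>i\<in>UNIV. \<Sum>m\<in>UNIV. (x $ j * e $ l * v $ i * \<mu> $ m) * C j l i m)" for x e j l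
  \<comment> \<open>Stated for arbitrary \<open>x\<close> and \<open>e\<close>, since the right-hand
    side of the claim is the same expression with the two vectors exchanged.\<close>
  have expand: "(\<Sum>l\<in>UNIV. e $ l * cpartial l (tri x v \<mu>) z) + tri e (bil z x v) \<mu> z
      + bil0 z x v * (\<Sum>m\<in>UNIV. e $ m * \<mu> $ m) = (\<Sum>j\<in>UNIV. \<Sum>l\<in>UNIV. F x e j l)" for x e
  proof -
    have 1: "(\<Sum>l\<in>UNIV. e $ l * cpartial l (tri x v \<mu>) z) = (\<Sum>j\<in>UNIV. \<Sum>l\<in>UNIV. \<Sum>i\<in>UNIV. \<Sum>m\<in>UNIV.
        (x $ j * e $ l * v $ i * \<mu> $ m) * cpartial l (P j i m) z)"
      by (subst sum.swap) (simp add: cpartial_tri[OF z] sum_distrib_left mult_ac)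
    have "tri e (bil z x v) \<mu> z = (\<Sum>l\<in>UNIV. \<Sum>k\<in>UNIV. \<Sum>m\<in>UNIV. \<Sum>j\<in>UNIV. \<Sum>i\<in>UNIV.
        (x $ j * e $ l * v $ i * \<mu> $ m) * (P j i k z * P l k m z))"
      by (simp add: tri_def bil_def sum_distrib_left sum_distrib_right mult_ac)
    also have "\<dots> = (\<Sum>j\<in>UNIV. \<Sum>l\<in>UNIV. \<Sum>i\<in>UNIV. \<Sum>m\<in>UNIV. \<Sum>k\<in>UNIV.
        (x $ j * e $ l * v $ i * \<mu> $ m) * (P j i k z * P l k m z))"
      unfolding sum.cartesian_product
      by (rule sum.reindex_bij_witness[where i = "\<lambda>(j, l, i, m, k). (l, k, m, j, i)"
            and j = "\<lambda>(l, k, m, j, i). (j, l, i, m, k)"]) auto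
    finally have 2: "tri e (bil z x v) \<mu> z = (\<Sum>j\<in>UNIV. \<Sum>l\<in>UNIV. \<Sum>i\<in>UNIV. \<Sum>m\<in>UNIV.
        (x $ j * e $ l * v $ i * \<mu> $ m) * (\<Sum>k\<in>UNIV. P j i k z * P l k m z))"
      by (simp add: sum_distrib_left)
    have "bil0 z x v * (\<Sum>m\<in>UNIV. e $ m * \<mu> $ m) = (\<Sum>j\<in>UNIV. \<Sum>i\<in>UNIV. \<Sum>l\<in>UNIV.
        (x $ j * e $ l * v $ i * \<mu> $ l) * P0 j i z)"
      by (simp add: bil0_def sum_distrib_left sum_distrib_right mult_ac)
    also have "\<dots> = (\<Sum>j\<in>UNIV. \<Sum>l\<in>UNIV. \<Sum>i\<in>UNIV. (x $ j * e $ l * v $ i * \<mu> $ l) * P0 j i z)"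
      by (intro sum.cong refl sum.swap)
    finally have 3: "bil0 z x v * (\<Sum>m\<in>UNIV. e $ m * \<mu> $ m) = (\<Sum>j\<in>UNIV. \<Sum>l\<in>UNIV. \<Sum>i\<in>UNIV. \<Sum>m\<in>UNIV.
        (x $ j * e $ l * v $ i * \<mu> $ m) * (if m = l then P0 j i z else 0))"
      by (simp add: if_distrib[where f="\<lambda>x. _ * x"] cong: if_cong)
    show ?thesis
      unfolding 1 2 3 F_def C_def distrib_left sum.distrib ..
  qed
  have "F x e j l = F e x l j" for j l
    using integrability_condition[OF z, of j l] by (simp add: F_def C_def mult_ac)
  then have "(\<Sum>j\<in>UNIV. \<Sum>l\<in>UNIV. F x e j l) = (\<Sum>l\<in>UNIV. \<Sum>j\<in>UNIV. F e x l j)"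
    by (subst sum.swap) simp
  then show ?thesis unfolding expand .
qed

end

subsection \<open>Estimates of the coefficients\<close>

lemma norm_two_axes:
  assumes "i \<noteq> j"
  shows "norm (axis i a + axis j b :: complex ^ 'n::finite) = sqrt ((norm a)\<^sup>2 + (norm b)\<^sup>2)"
proof -
  have "(\<Sum>k\<in>UNIV. (norm ((axis i a + axis j b :: complex ^ 'n) $ k))\<^sup>2)
      = (\<Sum>k\<in>UNIV. (if k = i then (norm a)\<^sup>2 else 0) + (if k = j then (norm b)\<^sup>2 else 0))"
    using assms by (intro sum.cong) (auto simp: axis_def)
  then show ?thesis by (simp add: norm_vec_def L2_set_def sum.distrib)
qed

lemma sum_two_axes_mult:
  "(\<Sum>k\<in>UNIV. (axis i a + axis j b :: complex ^ 'n::finite) $ k * F k) = a * F i + b * F j"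
  by (simp add: axis_def distrib_right sum.distrib if_distrib[where f="\<lambda>x. x * _"] cong: if_cong)

lemma norm_vec_power2: "(norm (x :: complex ^ 'n::finite))\<^sup>2 = (\<Sum>i\<in>UNIV. (norm (x $ i))\<^sup>2)"
  by (simp add: norm_vec_def L2_set_def sum_nonneg)

lemma norm_le_sqrt_card:
  fixes x :: "complex ^ 'n::finite"
  assumes "\<And>i. norm (x $ i) \<le> 1"
  shows "norm x \<le> sqrt (real CARD('n))"
proof -
  have "(norm x)\<^sup>2 \<le> (\<Sum>i\<in>(UNIV::'n set). 1)"
    unfolding norm_vec_power2 using assms by (intro sum_mono) (simp add: power_le_one)
  then show ?thesis by (simp add: real_le_rsqrt)
qed

lemma bergman_norm_torus:
  assumes "\<And>i. norm (z $ i) = r" "0 \<le> r" "r < 1"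
  shows "bergman_norm z v = sqrt 2 * norm v / (1 - r\<^sup>2)"
proof -
  have r: "0 < 1 - r\<^sup>2" using assms by (simp add: power_less_one_iff)
  have "bergman_norm z v = sqrt (2 * ((norm v)\<^sup>2 / (1 - r\<^sup>2)\<^sup>2))"
    unfolding bergman_norm_def norm_vec_power2 assms(1) by (simp add: sum_divide_distrib)
  also have "\<dots> = sqrt 2 * (norm v / (1 - r\<^sup>2))"
    using r by (simp add: real_sqrt_mult real_sqrt_divide)
  finally show ?thesis by simp
qed

text \<open>For vectors of equal norm the polarization identity and the parallelogram law give the
  bound with the same \<open>K\<close>. Scaling by \<open>c\<close> and \<open>1 / c\<close> reduces
  to that case.\<close>

lemma bilinear_polarization:
  fixes B :: "complex ^ 'n::finite \<Rightarrow> complex ^ 'n \<Rightarrow> complex ^ 'n"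
  assumes add: "\<And>x y w. B (x + y) w = B x w + B y w" "\<And>x y w. B w (x + y) = B w x + B w y"
    and smult: "\<And>c x y. B (c *s x) y = c *s B x y" "\<And>c x y. B x (c *s y) = c *s B x y"
    and sym: "\<And>x y. B x y = B y x"
    and quad: "\<And>v. norm (B v v) \<le> K * (norm v)\<^sup>2"
  shows "norm (B x y) \<le> K * norm x * norm y"
proof (cases "x = 0 \<or> y = 0")
  case True
  have "B 0 w = 0" "B w 0 = 0" for w
    using smult(1)[of 0 0 w] smult(2)[of w 0 0] by simp_all
  then show ?thesis using True by auto
next
  case False
  define c where "c = sqrt (norm y / norm x)"
  have c: "c > 0" using False by (simp add: c_def)
  have c2: "c\<^sup>2 = norm y / norm x" by (simp add: c_def)
  define X where "X = of_real c *s x"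
  define Y where "Y = of_real (1 / c) *s y"
  have nX: "(norm X)\<^sup>2 = norm x * norm y"
    unfolding X_def norm_vec_smult power_mult_distrib norm_of_real power2_abs c2
    using False by (simp add: power2_eq_square)
  have nY: "(norm Y)\<^sup>2 = norm x * norm y"
    unfolding Y_def norm_vec_smult power_mult_distrib norm_of_real power2_abs power_divide c2
    using False by (simp add: power2_eq_square)
  have "B X Y = (of_real c * of_real (1 / c)) *s B x y"
    by (simp add: X_def Y_def smult del: of_real_divide)
  also have "of_real c * of_real (1 / c) = (1::complex)"
    using c by (simp flip: of_real_mult)
  finally have XY: "B X Y = B x y" by simp
  have neg: "B w (- y) = - B w y" "B (- y) w = - B y w" for w y
    using smult(1)[of "-1" y w] smult(2)[of w "-1" y] by simp_all
  have "B (X + Y) (X + Y) - B (X - Y) (X - Y) = 4 *\<^sub>R B X Y"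
    unfolding diff_conv_add_uminus[of X Y] add neg
    using sym[of X Y] by (simp add: algebra_simps) (simp add: vec_eq_iff scaleR_conv_of_real)
  then have "4 * norm (B x y) = norm (B (X + Y) (X + Y) - B (X - Y) (X - Y))"
    by (simp add: XY)
  also have "\<dots> \<le> K * (norm (X + Y))\<^sup>2 + K * (norm (X - Y))\<^sup>2"
    by (rule order_trans[OF norm_triangle_ineq4 add_mono[OF quad quad]])
  also have "\<dots> = K * (2 * (norm X)\<^sup>2 + 2 * (norm Y)\<^sup>2)"
    unfolding power2_norm_eq_inner by (simp add: inner_add inner_diff inner_commute algebra_simps)
  also have "\<dots> = 4 * (K * norm x * norm y)" by (simp add: nX nY)
  finally show ?thesis by simp
qed

text \<open>For \<open>y = \<beta> * sqrt n\<close> the hypothesis gives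
  \<open>n * y \<le> sqrt 2 / 6.1\<close>, and each term is bounded through \<open>y\<close> or
  \<open>n * y\<close>.\<close>

lemma numerical_bound:
  fixes n \<alpha> \<beta> :: real
  assumes n: "n \<ge> 2" and \<alpha>: "\<alpha> \<ge> 0" "n * sqrt n * \<alpha> \<le> 1 / 6.1"
  defines "\<beta> \<equiv> sqrt 2 * \<alpha>"
  shows "\<beta> * sqrt n + sqrt n * (2 * \<beta>\<^sup>2 * sqrt n + 10 / 3 * \<beta> + 4 * \<beta> * sqrt (n - 1)) < 1"
proof -
  define y where "y = \<beta> * sqrt n"
  have y0: "y \<ge> 0" using n \<alpha> by (simp add: y_def \<beta>_def)
  have "n * y = sqrt 2 * (n * sqrt n * \<alpha>)" by (simp add: y_def \<beta>_def)
  also have "\<dots> \<le> 1.41422 * (1 / 6.1)"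
    using \<alpha> n by (intro mult_mono real_le_lsqrt) (auto simp: power2_eq_square)
  also have "\<dots> \<le> 0.2319" by simp
  finally have ny: "n * y \<le> 0.2319" .
  have "2 * y \<le> n * y" using n y0 by (rule mult_right_mono)
  then have y: "y \<le> 0.11595" using ny by simp
  \<comment> \<open>The resulting bound \<open>n / 2\<close> for \<open>sqrt (n - 1)\<close> is
    attained at \<open>n = 2\<close> and turns the last term into a multiple of
    \<open>n * y\<close>.\<close>
  have "n - 1 \<le> (n / 2)\<^sup>2"
    using zero_le_power2[of "n / 2 - 1"] by (simp add: power2_diff)
  then have "sqrt (n - 1) \<le> n / 2"
    using n by (intro real_le_lsqrt) auto
  then have "4 * y * sqrt (n - 1) \<le> 4 * y * (n / 2)"
    using y0 by (intro mult_left_mono) auto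
  then have 1: "4 * y * sqrt (n - 1) \<le> 0.4638" using ny by simp
  have 2: "y * y \<le> 0.11595 * 0.11595" using y y0 by (intro mult_mono) auto
  have "\<beta> * sqrt n + sqrt n * (2 * \<beta>\<^sup>2 * sqrt n + 10 / 3 * \<beta> + 4 * \<beta> * sqrt (n - 1))
      = y + 2 * (y * y) + 10 / 3 * y + 4 * y * sqrt (n - 1)"
    unfolding y_def by (simp add: power2_eq_square algebra_simps)
  also have "\<dots> < 1" using 1 2 y by simp
  finally show ?thesis .
qed

lemma max_norm_ge: "norm (z $ i) \<le> max_norm z" for z :: "complex ^ 'n::finite"
  unfolding max_norm_def by (rule Max_ge) auto

lemma max_norm_attained:
  obtains i where "norm ((z :: complex ^ 'n::finite) $ i) = max_norm z"
proof -
  have "max_norm z \<in> range (\<lambda>i. norm (z $ i))"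
    unfolding max_norm_def by (rule Max_in) auto
  then show ?thesis using that by auto
qed

section \<open>Coefficient bounds from the norm of the system\<close>

locale bounded_system = integrable_system P P0
  for P :: "'n::finite \<Rightarrow> 'n \<Rightarrow> 'n \<Rightarrow> complex ^ 'n \<Rightarrow> complex" and P0 +
  fixes \<alpha> :: real
  assumes \<alpha>: "\<alpha> \<ge> 0" and op_norm: "op_norm P \<le> ereal \<alpha>"
begin

definition \<beta> :: real where "\<beta> = sqrt 2 * \<alpha>"

lemma \<beta>_nonneg: "\<beta> \<ge> 0" using \<alpha> by (simp add: \<beta>_def)

lemma bil_smult: "bil z (c *s x) y = c *s bil z x y" "bil z x (c *s y) = c *s bil z x y"
  by (simp_all add: bil_def vec_eq_iff sum_distrib_left mult_ac)

lemma bil_add: "bil z (x + y) w = bil z x w + bil z y w" "bil z w (x + y) = bil z w x + bil z w y"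
  by (simp_all add: bil_def vec_eq_iff algebra_simps sum.distrib)

lemma bil_commute:
  assumes "z \<in> polydisc"
  shows "bil z x y = bil z y x"
proof -
  have "(\<Sum>i\<in>UNIV. \<Sum>j\<in>UNIV. P i j k z * x $ i * y $ j) = (\<Sum>j\<in>UNIV. \<Sum>i\<in>UNIV. P j i k z * y $ j * x $ i)" for k
    by (subst sum.swap) (simp add: coefficients_symmetric(1)[OF assms, of _ _ k] mult_ac)
  then show ?thesis by (simp add: bil_def)
qed

lemma bil_quadratic_torus:
  assumes z: "\<And>i. norm (z $ i) = r" and r: "0 \<le> r" "r < 1"
  shows "norm (bil z v v) \<le> \<beta> / (1 - r\<^sup>2) * (norm v)\<^sup>2"
proof (cases "v = 0")
  case True
  then have "bil z v v = 0" by (simp add: bil_def vec_eq_iff)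
  then show ?thesis using True by simp
next
  case False
  have \<delta>: "0 < 1 - r\<^sup>2" using r by (simp add: power_less_one_iff)
  \<comment> \<open>The Bergman norm of \<open>v\<close> at \<open>z\<close>, so that
    \<open>w\<close> is a unit vector in the supremum that defines \<open>op_norm\<close>.\<close>
  define c where "c = sqrt 2 * norm v / (1 - r\<^sup>2)"
  have c: "c > 0" using \<delta> False by (simp add: c_def)
  define w where "w = of_real (1 / c) *s v"
  have "bergman_norm z w = 1"
    using c \<delta> False unfolding bergman_norm_torus[OF z r] w_def norm_vec_smult norm_of_real
    by (simp add: c_def)
  moreover have "z \<in> polydisc" using z r by (simp add: polydisc_def)
  ultimately have "ereal (bergman_norm z (quad_op P z w)) \<le> op_norm P"
    unfolding op_norm_def by (intro SUP_upper2[of z] SUP_upper2[of w]) auto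
  then have "bergman_norm z (quad_op P z w) \<le> \<alpha>"
    using op_norm by (metis ereal_less_eq(3) order_trans)
  moreover have "quad_op P z w = of_real (1 / c) *s (of_real (1 / c) *s bil z v v)"
    by (simp only: w_def bil_smult[symmetric]) (simp add: quad_op_def bil_def)
  ultimately have "sqrt 2 * (norm (bil z v v) / c\<^sup>2) / (1 - r\<^sup>2) \<le> \<alpha>"
    using c unfolding bergman_norm_torus[OF z r] by (simp add: norm_vec_smult norm_divide norm_mult power2_eq_square)
  then have "norm (bil z v v) \<le> \<alpha> * (1 - r\<^sup>2) * c\<^sup>2 / sqrt 2"
    using c \<delta> by (simp add: field_simps)
  also have "\<dots> = \<beta> / (1 - r\<^sup>2) * (norm v)\<^sup>2"
  proof -
    have "c\<^sup>2 = 2 * (norm v)\<^sup>2 / (1 - r\<^sup>2)\<^sup>2"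
      by (simp add: c_def power_divide power_mult_distrib)
    moreover have "\<alpha> * D * (2 * V / D\<^sup>2) / sqrt 2 = sqrt 2 * \<alpha> / D * V" if "D > 0" for D V :: real
      using that by (simp add: field_simps power2_eq_square)
    ultimately show ?thesis using \<delta> by (simp only: \<beta>_def)
  qed
  finally show ?thesis .
qed

text \<open>For fixed vectors the right-hand side is constant on the torus of radius
  \<open>r\<close>, so the estimate there extends inward by
  \<open>polydisc_max_modulus\<close>.\<close>

lemma tri_bound:
  assumes z: "\<And>i. norm (z $ i) \<le> r" and r: "0 \<le> r" "r < 1"
  shows "norm (tri x y \<mu> z) \<le> \<beta> / (1 - r\<^sup>2) * norm x * norm y * norm \<mu>"
proof (rule polydisc_max_modulus[OF slice_tri r _ z])
  fix w :: "complex ^ 'n" assume w: "\<And>i. norm (w $ i) = r"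
  then have "w \<in> polydisc" using r by (simp add: polydisc_def)
  then have "norm (bil w x y) \<le> \<beta> / (1 - r\<^sup>2) * norm x * norm y"
    by (intro bilinear_polarization bil_add bil_smult bil_commute bil_quadratic_torus[OF w r])
  then have "norm (bil w x y) * norm \<mu> \<le> \<beta> / (1 - r\<^sup>2) * norm x * norm y * norm \<mu>"
    by (rule mult_right_mono) simp
  then show "norm (tri x y \<mu> w) \<le> \<beta> / (1 - r\<^sup>2) * norm x * norm y * norm \<mu>"
    unfolding tri_eq_bil by (rule order_trans[OF norm_bilinear_le])
qed

lemma bil_bound:
  assumes "\<And>i. norm (z $ i) \<le> r" "0 \<le> r" "r < 1"
  shows "norm (bil z x y) \<le> \<beta> / (1 - r\<^sup>2) * norm x * norm y"
proof (rule norm_le_of_bilinear)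
  show "norm (\<Sum>i\<in>UNIV. v $ i * bil z x y $ i) \<le> \<beta> / (1 - r\<^sup>2) * norm x * norm y * norm v" for v
    using tri_bound[OF assms, of x y v] by (simp add: tri_eq_bil mult.commute)
qed

text \<open>The integrability condition is contracted with a covector \<open>\<mu>\<close> annihilating the radial
  direction \<open>\<zeta>\<close> and a vector \<open>e\<close> with \<open>\<mu>(e) = 1\<close>. This isolates \<open>P\<^sup>0(\<zeta>, v)\<close>, and one of the two
  derivatives that remain is radial, where the sharper one-variable estimate applies.\<close>
lemma bil0_bound:
  assumes card: "CARD('n) \<ge> 2" and t: "0 \<le> t" "t < 1"
    and \<zeta>: "\<And>i. norm (\<zeta> $ i) \<le> 1" "norm (\<zeta> $ i0) = 1"
  defines "n \<equiv> real CARD('n)"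
  shows "norm (bil0 (of_real t *s \<zeta>) \<zeta> v)
    \<le> (2 * \<beta>\<^sup>2 * sqrt n + 10 / 3 * \<beta> + 4 * \<beta> * sqrt (n - 1)) / (1 - t\<^sup>2)\<^sup>2 * norm v"
proof -
  define z where "z = of_real t *s \<zeta>"
  have \<delta>: "0 < 1 - t\<^sup>2" using t by (simp add: power_less_one_iff)
  have zt: "norm (z $ i) \<le> t" for i
    using \<zeta>(1)[of i] t by (simp add: z_def norm_mult mult_left_le)
  have z: "z \<in> polydisc" using zt t by (auto simp: polydisc_def intro: le_less_trans)
  obtain j where j: "j \<noteq> i0"
  proof -
    have "UNIV \<noteq> {i0}"
    proof
      assume "UNIV = {i0}"
      then have "CARD('n) = card {i0}" by (rule arg_cong)
      then show False using card by simp
    qed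
    then show ?thesis using that by auto
  qed
  \<comment> \<open>This is the squared norm of \<open>\<mu>\<close>, and \<open>e\<close> is the
    conjugate of \<open>\<mu>\<close> divided by it. So \<open>\<mu>\<close> takes the value 1 on
    \<open>e\<close> while \<open>norm e * norm \<mu> = 1\<close>, the least possible
    product.\<close>
  define s where "s = 1 + (norm (\<zeta> $ j))\<^sup>2"
  have s: "s \<ge> 1" by (simp add: s_def)
  define \<mu> where "\<mu> = axis i0 (\<zeta> $ j) + axis j (- \<zeta> $ i0)"
  define e where "e = axis i0 (cnj (\<zeta> $ j) / of_real s) + axis j (- cnj (\<zeta> $ i0) / of_real s)"
  have n\<mu>: "norm \<mu> = sqrt s"
    unfolding \<mu>_def using j by (subst norm_two_axes) (auto simp: s_def \<zeta>(2) add.commute)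
  have ne: "norm e = 1 / sqrt s"
  proof -
    have "norm (cnj (\<zeta> $ j) / of_real s) = norm (\<zeta> $ j) / s" "norm (- cnj (\<zeta> $ i0) / of_real s) = 1 / s"
      using s \<zeta>(2) by (simp_all add: norm_divide)
    then have "norm e = sqrt ((norm (\<zeta> $ j) / s)\<^sup>2 + (1 / s)\<^sup>2)"
      unfolding e_def using j by (subst norm_two_axes) auto
    also have "(norm (\<zeta> $ j) / s)\<^sup>2 + (1 / s)\<^sup>2 = s / s\<^sup>2"
      by (simp add: power_divide add_divide_distrib[symmetric] s_def[symmetric] add.commute)
    finally show ?thesis using s by (simp add: power2_eq_square real_sqrt_divide)
  qed
  have e\<mu>1: "norm e * norm \<mu> = 1" using s by (simp add: ne n\<mu>)
  have e\<mu>: "(\<Sum>m\<in>UNIV. e $ m * \<mu> $ m) = 1"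
  proof -
    have "(\<Sum>m\<in>UNIV. e $ m * \<mu> $ m) = (cnj (\<zeta> $ j) * \<zeta> $ j + cnj (\<zeta> $ i0) * \<zeta> $ i0) / of_real s"
      unfolding e_def sum_two_axes_mult using j by (simp add: \<mu>_def axis_def add_divide_distrib)
    also have "cnj (\<zeta> $ j) * \<zeta> $ j + cnj (\<zeta> $ i0) * \<zeta> $ i0 = of_real s"
      unfolding mult.commute[of "cnj _"] complex_norm_square[symmetric] by (simp add: s_def \<zeta>(2))
    finally show ?thesis using s by simp
  qed
  have \<zeta>\<mu>: "(\<Sum>m\<in>UNIV. \<zeta> $ m * \<mu> $ m) = 0"
  proof -
    have "(\<Sum>m\<in>UNIV. \<mu> $ m * \<zeta> $ m) = 0"
      unfolding \<mu>_def sum_two_axes_mult by simp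
    then show ?thesis by (simp add: mult.commute)
  qed
  \<comment> \<open>\<open>polydisc_deriv_bound\<close> measures directions by their largest
    coordinate, where \<open>e\<close> has size \<open>1 / s\<close> instead of
    \<open>1 / sqrt s\<close>.\<close>
  have eb: "norm (e $ i) \<le> 1 / s" for i
    using \<zeta>(1)[of j] s by (simp add: e_def axis_def norm_divide \<zeta>(2) divide_right_mono)
  have n2: "n \<ge> 2" using card by (simp add: n_def)
  have \<zeta>n: "norm \<zeta> \<le> sqrt n"
    unfolding n_def by (rule norm_le_sqrt_card[OF \<zeta>(1)])
  \<comment> \<open>The coordinates \<open>i0\<close> and \<open>j\<close> contribute exactly
    \<open>s\<close>, the others at most 1 each. The factor \<open>sqrt s\<close> cancels in
    \<open>T2\<close> and leaves \<open>sqrt (n - 1)\<close> there.\<close>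
  have \<zeta>s: "norm \<zeta> \<le> sqrt (n - 1) * sqrt s"
  proof -
    have "(norm \<zeta>)\<^sup>2 = (norm (\<zeta> $ i0))\<^sup>2 + ((norm (\<zeta> $ j))\<^sup>2 + (\<Sum>i\<in>UNIV - {i0} - {j}. (norm (\<zeta> $ i))\<^sup>2))"
      unfolding norm_vec_power2 using j by (subst sum.remove[of _ i0], simp, simp, subst sum.remove[of _ j]) auto
    also have "\<dots> \<le> s + (\<Sum>i\<in>UNIV - {i0} - {j}. 1)"
    proof -
      have "(\<Sum>i\<in>UNIV - {i0} - {j}. (norm (\<zeta> $ i))\<^sup>2) \<le> (\<Sum>i\<in>UNIV - {i0} - {j}. 1)"
        using \<zeta>(1) by (intro sum_mono) (simp add: power_le_one)
      then show ?thesis by (simp add: s_def \<zeta>(2))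
    qed
    also have "(\<Sum>i\<in>UNIV - {i0} - {j}. 1) = n - 2"
      using j card by (simp add: card_Diff_singleton n_def of_nat_diff)
    also have "s + (n - 2) \<le> (n - 1) * s"
      using mult_left_mono[of 1 s "n - 2"] s n2 by (simp add: algebra_simps)
    finally show ?thesis by (simp add: real_le_rsqrt real_sqrt_mult[symmetric])
  qed
  define Q where "Q = (1 - t\<^sup>2)\<^sup>2"
  have Q: "Q > 0" using \<delta> by (simp add: Q_def)
  have T1: "norm (\<Sum>l\<in>UNIV. \<zeta> $ l * cpartial l (tri e v \<mu>) z) \<le> 10 / 3 * \<beta> / Q * norm v"
  proof -
    \<comment> \<open>On the complex line through \<open>\<zeta>\<close> the bound for
      \<open>tri\<close> has exactly the growth that \<open>deriv_bound_weighted_disc\<close>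
      requires.\<close>
    define f where "f a = tri e v \<mu> (0 + a *s \<zeta>)" for a
    have in_poly: "0 + a *s \<zeta> \<in> polydisc" if "norm a < 1" for a
      using \<zeta>(1) that unfolding polydisc_def
      by (auto simp: norm_mult intro: le_less_trans[OF mult_left_le])
    have der: "(f has_field_derivative (\<Sum>l\<in>UNIV. \<zeta> $ l * cpartial l (tri e v \<mu>) (0 + a *s \<zeta>))) (at a)"
      if "norm a < 1" for a
      unfolding f_def by (rule slice_holomorphic_line[OF slice_tri in_poly[OF that]])
    have "norm (deriv f (of_real t)) \<le> 10 / 3 * (\<beta> * norm v) / (1 - t\<^sup>2)\<^sup>2"
    proof (rule deriv_bound_weighted_disc[OF _ _ t])
      show "f holomorphic_on ball 0 1"
        unfolding holomorphic_on_def
        using der field_differentiable_at_within field_differentiable_def by (metis dist_0_norm mem_ball)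
      fix a :: complex assume a: "norm a < 1"
      have "norm (f a) \<le> \<beta> / (1 - (norm a)\<^sup>2) * norm e * norm v * norm \<mu>"
        unfolding f_def by (rule tri_bound) (use \<zeta>(1) a in \<open>auto simp: norm_mult mult_left_le\<close>)
      also have "\<dots> = \<beta> / (1 - (norm a)\<^sup>2) * norm v * (norm e * norm \<mu>)" by simp
      finally show "norm (f a) \<le> \<beta> * norm v / (1 - (norm a)\<^sup>2)"
        unfolding e\<mu>1 by simp
    qed
    moreover have "deriv f (of_real t) = (\<Sum>l\<in>UNIV. \<zeta> $ l * cpartial l (tri e v \<mu>) z)"
      using DERIV_imp_deriv[OF der[of "of_real t"]] t by (simp add: z_def)
    ultimately show ?thesis by (simp add: Q_def)
  qed
  have T2: "norm (\<Sum>l\<in>UNIV. e $ l * cpartial l (tri \<zeta> v \<mu>) z) \<le> 4 * \<beta> * sqrt (n - 1) / Q * norm v"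
  proof -
    \<comment> \<open>\<open>R^2\<close> is the midpoint of \<open>t^2\<close> and 1, which
      maximizes \<open>(1 - R^2) * (R^2 - t^2)\<close>. Both factors are then
      \<open>(1 - t^2) / 2\<close>, whence the constant 4.\<close>
    define R where "R = sqrt ((1 + t\<^sup>2) / 2)"
    have R2: "R\<^sup>2 = (1 + t\<^sup>2) / 2" by (simp add: R_def)
    have R: "t < R" "R < 1"
      using \<delta> t by (auto simp: R_def intro!: real_less_rsqrt)
    define M where "M = \<beta> / (1 - R\<^sup>2) * norm \<zeta> * norm v * norm \<mu>"
    have "norm (\<Sum>l\<in>UNIV. e $ l * cpartial l (tri \<zeta> v \<mu>) z) \<le> M * (1 / s) * R / (R\<^sup>2 - t\<^sup>2)"
    proof (rule polydisc_deriv_bound[OF holomorphic_cn_tri t(1) R _ zt eb])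
      fix w :: "complex ^ 'n" assume "\<And>i. norm (w $ i) \<le> R"
      then show "norm (tri \<zeta> v \<mu> w) \<le> M"
        unfolding M_def using R t by (intro tri_bound) auto
    qed (use s in simp)
    also have "M * (1 / s) * R / (R\<^sup>2 - t\<^sup>2) = 4 * \<beta> / Q * norm v * (norm \<zeta> * (norm \<mu> / s)) * R"
    proof -
      have eq: "1 - R\<^sup>2 = (1 - t\<^sup>2) / 2" "R\<^sup>2 - t\<^sup>2 = (1 - t\<^sup>2) / 2"
        by (simp_all add: R2 field_simps)
      show ?thesis
        unfolding M_def Q_def eq using \<delta> s by (simp add: power2_eq_square mult_ac)
    qed
    also have "norm \<mu> / s = 1 / sqrt s" using s by (simp add: n\<mu> divide_simps)
    also have "4 * \<beta> / Q * norm v * (norm \<zeta> * (1 / sqrt s)) * R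
        \<le> 4 * \<beta> / Q * norm v * sqrt (n - 1) * 1"
    proof (intro mult_mono mult_nonneg_nonneg)
      show "norm \<zeta> * (1 / sqrt s) \<le> sqrt (n - 1)"
        using \<zeta>s s by (simp add: divide_le_eq)
    qed (use R t s n2 Q \<beta>_nonneg in auto)
    finally show ?thesis by (simp add: mult_ac)
  qed
  have T3: "norm (tri e (bil z \<zeta> v) \<mu> z) \<le> \<beta>\<^sup>2 * sqrt n / Q * norm v"
  proof -
    have "norm (tri e (bil z \<zeta> v) \<mu> z) \<le> \<beta> / (1 - t\<^sup>2) * norm e * norm (bil z \<zeta> v) * norm \<mu>"
      by (rule tri_bound[OF zt t])
    also have "\<dots> = \<beta> / (1 - t\<^sup>2) * norm (bil z \<zeta> v) * (norm e * norm \<mu>)" by simp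
    also have "\<dots> = \<beta> / (1 - t\<^sup>2) * norm (bil z \<zeta> v)" by (simp add: e\<mu>1)
    also have "\<dots> \<le> \<beta> / (1 - t\<^sup>2) * (\<beta> / (1 - t\<^sup>2) * sqrt n * norm v)"
    proof (intro mult_left_mono)
      have "norm (bil z \<zeta> v) \<le> \<beta> / (1 - t\<^sup>2) * norm \<zeta> * norm v"
        by (rule bil_bound[OF zt t])
      also have "\<dots> \<le> \<beta> / (1 - t\<^sup>2) * sqrt n * norm v"
        using \<delta> \<beta>_nonneg \<zeta>n by (intro mult_right_mono mult_left_mono) auto
      finally show "norm (bil z \<zeta> v) \<le> \<beta> / (1 - t\<^sup>2) * sqrt n * norm v" .
    qed (use \<delta> \<beta>_nonneg in auto)
    finally show ?thesis by (simp add: Q_def power2_eq_square)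
  qed
  have T4: "norm (tri \<zeta> (bil z e v) \<mu> z) \<le> \<beta>\<^sup>2 * sqrt n / Q * norm v"
  proof -
    have "norm (tri \<zeta> (bil z e v) \<mu> z) \<le> \<beta> / (1 - t\<^sup>2) * norm \<zeta> * norm (bil z e v) * norm \<mu>"
      by (rule tri_bound[OF zt t])
    also have "\<dots> \<le> \<beta> / (1 - t\<^sup>2) * sqrt n * (\<beta> / (1 - t\<^sup>2) * norm e * norm v) * norm \<mu>"
      using \<delta> \<beta>_nonneg \<zeta>n n2 bil_bound[OF zt t, of e v]
      by (intro mult_right_mono mult_mono mult_left_mono) auto
    also have "\<dots> = \<beta> / (1 - t\<^sup>2) * sqrt n * (\<beta> / (1 - t\<^sup>2) * norm v) * (norm e * norm \<mu>)" by simp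
    finally show ?thesis unfolding e\<mu>1 by (simp add: Q_def power2_eq_square mult_ac)
  qed
  have "bil0 z \<zeta> v = (\<Sum>l\<in>UNIV. \<zeta> $ l * cpartial l (tri e v \<mu>) z) + tri \<zeta> (bil z e v) \<mu> z
      - ((\<Sum>l\<in>UNIV. e $ l * cpartial l (tri \<zeta> v \<mu>) z) + tri e (bil z \<zeta> v) \<mu> z)"
    using contracted_integrability[OF z, of e \<zeta> v \<mu>] unfolding e\<mu> \<zeta>\<mu> by (simp add: algebra_simps)
  then have "norm (bil0 z \<zeta> v) \<le> (10 / 3 * \<beta> / Q * norm v + \<beta>\<^sup>2 * sqrt n / Q * norm v)
      + (4 * \<beta> * sqrt (n - 1) / Q * norm v + \<beta>\<^sup>2 * sqrt n / Q * norm v)"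
    by (simp only:) (intro order_trans[OF norm_triangle_ineq4] order_trans[OF norm_triangle_ineq]
        add_mono T1 T2 T3 T4)
  also have "\<dots> = (2 * \<beta>\<^sup>2 * sqrt n + 10 / 3 * \<beta> + 4 * \<beta> * sqrt (n - 1)) / Q * norm v"
    by (simp add: add_divide_distrib algebra_simps)
  finally show ?thesis by (simp add: z_def Q_def)
qed

section \<open>The solution along a ray\<close>

text \<open>\<open>ray_comparison\<close> is applied to the value and the gradient with
  \<open>c = sqrt n\<close>; \<open>a\<close> comes from \<open>tri_bound\<close> with
  \<open>norm \<zeta> \<le> sqrt n\<close>, and \<open>b\<close> from
  \<open>bil0_bound\<close>.\<close>

lemma solution_ray_bound:
  assumes card: "CARD('n) \<ge> 2" and small: "real CARD('n) * sqrt (real CARD('n)) * \<alpha> \<le> 1 / 6.1"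
    and u: "solves u" "u 0 = 1" "cgrad u 0 = 0"
    and t: "0 \<le> t" "t < 1" and \<zeta>: "\<And>i. norm (\<zeta> $ i) \<le> 1" "norm (\<zeta> $ i0) = 1"
  defines "z \<equiv> of_real t *s \<zeta>"
  shows "1 - t \<le> norm (u z) \<and> norm (cgrad u z) \<le> t / (sqrt (real CARD('n)) * (1 - t\<^sup>2)) * norm (u z)"
proof -
  define n where "n = real CARD('n)"
  have n2: "n \<ge> 2" using card by (simp add: n_def)
  \<comment> \<open>The summand 0 is the base point of the line, in the form that
    \<open>solves_line_derivative\<close> expects.\<close>
  define x where "x t = 0 + of_real t *s \<zeta>" for t :: real
  define U' where "U' t = (\<Sum>j\<in>UNIV. \<zeta> $ j * cpartial j u (x t))" for t
  define W' where "W' t = (\<chi> i. \<Sum>j\<in>UNIV. \<zeta> $ j * ((\<Sum>k\<in>UNIV. P j i k (x t) * cpartial k u (x t))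
        + P0 j i (x t) * u (x t)))" for t
  define a where "a = \<beta> * sqrt n"
  define b where "b = 2 * \<beta>\<^sup>2 * sqrt n + 10 / 3 * \<beta> + 4 * \<beta> * sqrt (n - 1)"
  have xt: "norm (x t $ i) \<le> t" if "0 \<le> t" "t < 1" for t i
    using \<zeta>(1)[of i] that by (simp add: x_def norm_mult mult_left_le)
  have x: "x t \<in> polydisc" if "0 \<le> t" "t < 1" for t
    using xt[OF that] that by (auto simp: polydisc_def intro: le_less_trans)
  have \<zeta>n: "norm \<zeta> \<le> sqrt n"
    unfolding n_def by (rule norm_le_sqrt_card[OF \<zeta>(1)])
  have "1 - t \<le> norm (u (x t)) \<and> norm (cgrad u (x t)) \<le> t / (sqrt n * (1 - t\<^sup>2)) * norm (u (x t))"
  proof (rule ray_comparison[where U' = U' and W' = W' and a = a and b = b])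
    fix t :: real assume t: "0 \<le> t" "t < 1"
    have \<delta>: "0 < 1 - t\<^sup>2" using t by (simp add: power_less_one_iff)
    have xt': "0 + of_real t *s \<zeta> \<in> polydisc" using x[OF t] by (simp only: x_def)
    show "((\<lambda>t. u (x t)) has_vector_derivative U' t) (at t)"
      unfolding U'_def x_def by (rule solves_line_derivative(1)[OF u(1) xt'])
    show "((\<lambda>t. cgrad u (x t)) has_vector_derivative W' t) (at t)"
      unfolding W'_def cgrad_def x_def
      by (rule has_vector_derivative_vec_lambda) (rule solves_line_derivative(2)[OF u(1) xt'])
    show "norm (U' t) \<le> sqrt n * norm (cgrad u (x t))"
    proof -
      have "norm (U' t) \<le> norm \<zeta> * norm (cgrad u (x t))"
        using norm_bilinear_le[of \<zeta> "cgrad u (x t)"] by (simp add: U'_def cgrad_def)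
      also have "\<dots> \<le> sqrt n * norm (cgrad u (x t))"
        using \<zeta>n by (rule mult_right_mono) simp
      finally show ?thesis .
    qed
    show "norm (W' t) \<le> a / (1 - t\<^sup>2) * norm (cgrad u (x t)) + b / (1 - t\<^sup>2)\<^sup>2 * norm (u (x t))"
    proof (rule norm_le_of_bilinear)
      fix v :: "complex ^ 'n"
      \<comment> \<open>Paired with \<open>v\<close>, the right-hand side of the ODE splits into
        \<open>tri\<close> and \<open>bil0\<close>, for which bounds are available.\<close>
      have "(\<Sum>i\<in>UNIV. v $ i * W' t $ i) = (\<Sum>i\<in>UNIV. \<Sum>j\<in>UNIV. \<Sum>k\<in>UNIV. (\<zeta> $ j * v $ i * cgrad u (x t) $ k) * P j i k (x t))
         + (\<Sum>i\<in>UNIV. \<Sum>j\<in>UNIV. P0 j i (x t) * \<zeta> $ j * v $ i * u (x t))"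
        by (simp add: W'_def cgrad_def sum_distrib_left sum_distrib_right distrib_left sum.distrib mult_ac)
      also have "\<dots> = tri \<zeta> v (cgrad u (x t)) (x t) + bil0 (x t) \<zeta> v * u (x t)"
      proof (rule arg_cong2[where f = "(+)"])
        show "(\<Sum>i\<in>UNIV. \<Sum>j\<in>UNIV. \<Sum>k\<in>UNIV. (\<zeta> $ j * v $ i * cgrad u (x t) $ k) * P j i k (x t))
            = tri \<zeta> v (cgrad u (x t)) (x t)"
          unfolding tri_def by (rule sum.swap)
        have "(\<Sum>i\<in>UNIV. \<Sum>j\<in>UNIV. P0 j i (x t) * \<zeta> $ j * v $ i * u (x t))
            = (\<Sum>j\<in>UNIV. \<Sum>i\<in>UNIV. P0 j i (x t) * \<zeta> $ j * v $ i * u (x t))"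
          by (rule sum.swap)
        then show "(\<Sum>i\<in>UNIV. \<Sum>j\<in>UNIV. P0 j i (x t) * \<zeta> $ j * v $ i * u (x t)) = bil0 (x t) \<zeta> v * u (x t)"
          by (simp add: bil0_def sum_distrib_right)
      qed
      also have "norm \<dots> \<le> norm (tri \<zeta> v (cgrad u (x t)) (x t)) + norm (bil0 (x t) \<zeta> v) * norm (u (x t))"
        by (rule order_trans[OF norm_triangle_ineq]) (simp add: norm_mult)
      also have "\<dots> \<le> a / (1 - t\<^sup>2) * norm v * norm (cgrad u (x t)) + (b / (1 - t\<^sup>2)\<^sup>2 * norm v) * norm (u (x t))"
      proof (intro add_mono mult_right_mono)
        have "norm (tri \<zeta> v (cgrad u (x t)) (x t)) \<le> \<beta> / (1 - t\<^sup>2) * norm \<zeta> * norm v * norm (cgrad u (x t))"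
          by (rule tri_bound[OF xt[OF t] t])
        also have "\<dots> \<le> \<beta> / (1 - t\<^sup>2) * sqrt n * norm v * norm (cgrad u (x t))"
          using \<delta> \<beta>_nonneg \<zeta>n by (intro mult_right_mono mult_left_mono) auto
        finally show "norm (tri \<zeta> v (cgrad u (x t)) (x t)) \<le> a / (1 - t\<^sup>2) * norm v * norm (cgrad u (x t))"
          by (simp add: a_def)
        show "norm (bil0 (x t) \<zeta> v) \<le> b / (1 - t\<^sup>2)\<^sup>2 * norm v"
          using bil0_bound[OF card t \<zeta>, of v] by (simp add: x_def b_def n_def)
      qed simp
      finally show "norm (\<Sum>i\<in>UNIV. v $ i * W' t $ i)
          \<le> (a / (1 - t\<^sup>2) * norm (cgrad u (x t)) + b / (1 - t\<^sup>2)\<^sup>2 * norm (u (x t))) * norm v"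
        by (simp add: algebra_simps)
    qed
  next
    show "a + sqrt n * b < 1"
      using numerical_bound[OF n2 \<alpha>] small by (simp add: a_def b_def n_def \<beta>_def)
  qed (use t u n2 \<beta>_nonneg in \<open>auto simp: x_def a_def\<close>)
  then show ?thesis by (simp add: x_def z_def n_def)
qed

end

theorem theorem3p8:
  fixes P :: "'n::finite \<Rightarrow> 'n \<Rightarrow> 'n \<Rightarrow> complex ^ 'n \<Rightarrow> complex"
    and P0 :: "'n \<Rightarrow> 'n \<Rightarrow> complex ^ 'n \<Rightarrow> complex"
    and u :: "complex ^ 'n \<Rightarrow> complex"
    and \<alpha> :: real
  assumes "CARD('n) \<ge> 2"
    and "\<alpha> \<ge> 0"
    and "\<And>i j k. holomorphic_cn (P i j k) polydisc"
    and "\<And>i j. holomorphic_cn (P0 i j) polydisc"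
    and "completely_integrable P P0"
    and "canonical_form P"
    and "op_norm P \<le> ereal \<alpha>"
    and "is_solution P P0 u"
    and "u 0 = 1"
    and "cgrad u 0 = 0"
    and "real CARD('n) * sqrt (real CARD('n)) * \<alpha> \<le> 1 / 6.1"
  shows "\<forall>z\<in>polydisc. u z \<noteq> 0 \<and>
           norm (\<chi> i. cgrad u z $ i / u z) \<le> max_norm z / (1 - (max_norm z)\<^sup>2)"
proof
  fix z :: "complex ^ 'n" assume z: "z \<in> polydisc"
  interpret bounded_system P P0 \<alpha>
    by unfold_locales (use assms in auto)
  have sol: "solves u" by (rule is_solution_imp_solves[OF assms(8)])
  define t where "t = max_norm z"
  obtain i0 where i0: "norm (z $ i0) = t" using max_norm_attained unfolding t_def by blast
  have t: "0 \<le> t" "t < 1" using i0 z norm_ge_zero[of "z $ i0"] by (auto simp: polydisc_def simp flip: i0)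
  have \<delta>: "0 < 1 - t\<^sup>2" using t by (simp add: power_less_one_iff)
  have quot: "norm (\<chi> i. cgrad u z $ i / u z) = norm (cgrad u z) / norm (u z)"
  proof -
    have "(\<chi> i. cgrad u z $ i / u z) = (1 / u z) *s cgrad u z" by (simp add: vec_eq_iff)
    then show ?thesis by (simp add: norm_vec_smult norm_divide)
  qed
  show "u z \<noteq> 0 \<and> norm (\<chi> i. cgrad u z $ i / u z) \<le> max_norm z / (1 - (max_norm z)\<^sup>2)"
  proof (cases "t = 0")
    \<comment> \<open>The origin determines no direction \<open>\<zeta>\<close>; there the initial
      values give the claim.\<close>
    case True
    then have "z $ i = 0" for i
      using max_norm_ge[of z i] by (simp add: t_def)
    then have "z = 0" by (simp add: vec_eq_iff)
    then show ?thesis using assms(9,10) True quot by (simp add: t_def)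
  next
    case False
    define \<zeta> where "\<zeta> = of_real (1 / t) *s z"
    have z_eq: "of_real t *s \<zeta> = z" using False by (simp add: \<zeta>_def)
    have \<zeta>: "norm (\<zeta> $ i) \<le> 1" "norm (\<zeta> $ i0) = 1" for i
      using False t max_norm_ge[of z i] i0 by (simp_all add: \<zeta>_def norm_divide t_def divide_le_eq)
    from solution_ray_bound[OF assms(1,11) sol assms(9,10) t \<zeta>]
    have lower: "1 - t \<le> norm (u z)"
      and upper: "norm (cgrad u z) \<le> t / (sqrt (real CARD('n)) * (1 - t\<^sup>2)) * norm (u z)"
      by (simp_all add: z_eq)
    have pos: "norm (u z) > 0" using lower t by linarith
    have "norm (cgrad u z) / norm (u z) \<le> t / (sqrt (real CARD('n)) * (1 - t\<^sup>2))"
      using upper pos by (simp add: pos_divide_le_eq)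
    \<comment> \<open>The ray estimate is better by the factor \<open>sqrt n\<close>, which is at
      least 1 and is given away here.\<close>
    also have "\<dots> \<le> t / (1 * (1 - t\<^sup>2))"
      using t \<delta> assms(1) by (intro divide_left_mono mult_right_mono) auto
    finally show ?thesis using pos quot by (simp add: t_def)
  qed
qed

end
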